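(* Let $N\ge 2$ and let $U_1,\dots,U_N,V_1,\dots,V_{N-1}:\mathbb{R}\to\mathbb{R}$ be smooth ($C^\infty$) functions. Suppose that there is $R\ge 0$ such that $V_k''(x)>0$ for $|x|\ge R$ and all $1\le k\le N-1$; that $U_k'(x)\to\pm\infty$ as $x\to\pm\infty$ for all $1\le k\le N$; and that for all $1\le k\le N-1$ and every $x\in\mathbb{R}$, $V_k''(x)\neq 0$ or $V_k'''(x)\ne 0$. Let $r=3\cdot 2^{N+1}-5$ and let $K\subset\mathbb{R}^{2N}$ be a bounded set such that for every $(p,q)\in\mathbb{R}^{2N}\setminus K$ there exists $1\le j\le r$ with $L_F^jH(p,q)\ne0$ (such a set $K$ exists). Let $Q\in\mathbb{R}$ be such that $\mathcal{K}_Q^H:=\{x\in\mathbb{R}^{2N}: H(x)\le Q\}\supset K$. Then the Hamiltonian $H$ of the oscillator chain is a non-strict Lyapunov function outside $\mathcal{K}^H_Q$ for the damped oscillator system, and $$\big(L_FH(x),L_F^2H(x),\dots,L_F^rH(x)\big)\neq 0\qquad\text{for all } x\notin\mathcal{K}_Q^H .$$ Hence the damped oscillator system admits a strict Lyapunov function $W^\sharp$ outside a compact set, given by the construction described in the context with this $r$ and $Q$.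
   Context: The chain of oscillators has phase space $\mathbb{R}^{2N}\ni x=(p,q)$ and Hamiltonian $$H(p,q)=\sum_{j=1}^N\frac{p_j^2}{2}+\sum_{j=1}^NU_j(q_j)+\sum_{j=1}^{N-1}V_j(q_j-q_{j+1}).$$ The damped oscillator system is $$\dot q_j=p_j,\qquad \dot p_j=-\delta_{j1}p_1-U_j'(q_j)+V_{j-1}'(q_{j-1}-q_j)-V_j'(q_j-q_{j+1}),\qquad 1\le j\le N,$$ where $V_0=V_N:=0$. $F$ denotes the vector field on the right-hand side, $L_Ff=\operatorname{grad}(f)\cdot F$, and $L_F^j$ is the $j$-th iterate of $L_F$. A function is proper if all its sublevel sets $\{f\le c\}$, $c\in\mathbb{R}$, are compact. A $C^1$-smooth function $W$ is a strict (respectively non-strict) Lyapunov function outside a compact set if it is proper and for some $Q'\in\mathbb{R}$ one has $L_FW(x)<0$ (respectively $\le 0$) for all $x$ with $W(x)>Q'$; to specify $Q'$ one says "outside the compact set $\{W\le Q'\}$". Construction of $W^\sharp$: choose smooth positive functions $\varphi,\Phi:(Q,\infty)\to(0,\infty)$ with $\varphi\le\Phi^2$ such that for all $x\notin\mathcal{K}_Q^H$, $|L_FH(x)|+\sum_{k=2}^r|L_F^kH(x)|^2\ge\varphi(H(x))$ and $|L_F^kH(x)|\le\Phi(H(x))$ for $1\le k\le r+1$. Set $B_k=2^{(r-k)(r-k+1)}(\Phi^2/\varphi)^{r-k}$ for $2\le k\le r$, and let $A:(Q,\infty)\to\mathbb{R}$ be a smooth function with $A'>\Phi^2\sum_{k=2}^r|B_k'|+\Phi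 B_2+1$, growing at infinity fast enough for $W^\sharp$ to be proper. For $\varepsilon>0$ and $x\notin\mathcal{K}^H_{Q+\varepsilon}$ put $$W^\sharp(x)=A(H(x))-\sum_{k=2}^rB_k(H(x))\,L_F^{k-1}H(x)\,L_F^kH(x),$$ and extend $W^\sharp$ in any way to a $C^1$-smooth function on $\mathbb{R}^{2N}$. *)

theory Defs
  imports "HOL-Analysis.Analysis"
begin

section \<open>Smoothness\<close>

text \<open>Meant for open \<open>S\<close>; then the iterated derivatives at points of \<open>S\<close> do not depend on
  the values of \<open>f\<close> outside \<open>S\<close>.\<close>

definition smooth_real_on :: "real set \<Rightarrow> (real \<Rightarrow> real) \<Rightarrow> bool" where
  "smooth_real_on S f \<longleftrightarrow> (\<forall>k. \<forall>x\<in>S. (deriv ^^ k) f differentiable (at x))"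

definition C1_smooth :: "('a::real_inner \<Rightarrow> real) \<Rightarrow> bool" where
  "C1_smooth f \<longleftrightarrow> (\<exists>g. (\<forall>x. GDERIV f x :> g x) \<and> continuous_on UNIV g)"


section \<open>Lie derivatives and Lyapunov functions\<close>

definition grad :: "('a::real_inner \<Rightarrow> real) \<Rightarrow> 'a \<Rightarrow> 'a" where
  "grad f x = (THE g. GDERIV f x :> g)"

definition lie :: "('a::real_inner \<Rightarrow> 'a) \<Rightarrow> ('a \<Rightarrow> real) \<Rightarrow> 'a \<Rightarrow> real" where
  "lie F f = (\<lambda>x. grad f x \<bullet> F x)"

definition proper_fun :: "('a::topological_space \<Rightarrow> real) \<Rightarrow> bool" where
  "proper_fun f \<longleftrightarrow> (\<forall>c. compact {x. f x \<le> c})"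

definition strict_lyapunov_outside ::
    "('a::real_inner \<Rightarrow> 'a) \<Rightarrow> ('a \<Rightarrow> real) \<Rightarrow> real \<Rightarrow> bool" where
  "strict_lyapunov_outside F W Q' \<longleftrightarrow>
     C1_smooth W \<and> proper_fun W \<and> (\<forall>x. W x > Q' \<longrightarrow> lie F W x < 0)"

definition nonstrict_lyapunov_outside ::
    "('a::real_inner \<Rightarrow> 'a) \<Rightarrow> ('a \<Rightarrow> real) \<Rightarrow> real \<Rightarrow> bool" where
  "nonstrict_lyapunov_outside F W Q' \<longleftrightarrow>
     C1_smooth W \<and> proper_fun W \<and> (\<forall>x. W x > Q' \<longrightarrow> lie F W x \<le> 0)"


section \<open>The chain of oscillators\<close>

text \<open>The phase space is \<open>(real^'n) \<times> (real^'n)\<close> with points \<open>(p, q)\<close> and \<open>N = CARD('n)\<close>. The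
  map \<open>idx\<close>, a bijection from \<open>{1..N}\<close> onto \<open>'n\<close>, enumerates the coordinates along the chain:
  \<open>p\<^sub>j = p $ idx j\<close> and \<open>q\<^sub>j = q $ idx j\<close>.\<close>

definition hamiltonian ::
    "(nat \<Rightarrow> 'n::finite) \<Rightarrow> (nat \<Rightarrow> real \<Rightarrow> real) \<Rightarrow> (nat \<Rightarrow> real \<Rightarrow> real)
      \<Rightarrow> (real^'n) \<times> (real^'n) \<Rightarrow> real" where
  "hamiltonian idx U V = (\<lambda>(p, q).
     (\<Sum>j = 1..CARD('n). (p $ idx j)\<^sup>2 / 2)
     + (\<Sum>j = 1..CARD('n). U j (q $ idx j))
     + (\<Sum>j = 1..CARD('n) - 1. V j (q $ idx j - q $ idx (j + 1))))"

text \<open>The convention \<open>V\<^sub>0 = V\<^sub>N = 0\<close>; it also makes the values of \<open>idx\<close> outside \<open>{1..N}\<close>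
  irrelevant in \<open>damped_force\<close>.\<close>

definition bdry_V :: "nat \<Rightarrow> (nat \<Rightarrow> real \<Rightarrow> real) \<Rightarrow> nat \<Rightarrow> real \<Rightarrow> real" where
  "bdry_V N V j = (if 1 \<le> j \<and> j < N then V j else (\<lambda>_. 0))"

definition damped_force ::
    "(nat \<Rightarrow> 'n::finite) \<Rightarrow> (nat \<Rightarrow> real \<Rightarrow> real) \<Rightarrow> (nat \<Rightarrow> real \<Rightarrow> real)
      \<Rightarrow> real^'n \<Rightarrow> real^'n \<Rightarrow> nat \<Rightarrow> real" where
  "damped_force idx U V p q j =
     - (if j = 1 then p $ idx 1 else 0)
     - deriv (U j) (q $ idx j)
     + deriv (bdry_V CARD('n) V (j - 1)) (q $ idx (j - 1) - q $ idx j)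
     - deriv (bdry_V CARD('n) V j) (q $ idx j - q $ idx (j + 1))"

definition damped_field ::
    "(nat \<Rightarrow> 'n::finite) \<Rightarrow> (nat \<Rightarrow> real \<Rightarrow> real) \<Rightarrow> (nat \<Rightarrow> real \<Rightarrow> real)
      \<Rightarrow> (real^'n) \<times> (real^'n) \<Rightarrow> (real^'n) \<times> (real^'n)" where
  "damped_field idx U V = (\<lambda>(p, q).
     (\<chi> i. damped_force idx U V p q (inv_into {1..CARD('n)} idx i), p))"


definition nondeg_off ::
    "('a::real_inner \<Rightarrow> 'a) \<Rightarrow> ('a \<Rightarrow> real) \<Rightarrow> nat \<Rightarrow> 'a set \<Rightarrow> bool" where
  "nondeg_off F H r K \<longleftrightarrow>
     bounded K \<and> (\<forall>x. x \<notin> K \<longrightarrow> (\<exists>j\<in>{1..r}. (lie F ^^ j) H x \<noteq> 0))"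


section \<open>The construction of the strict Lyapunov function\<close>

text \<open>Functions on \<open>(Q, \<infinity>)\<close> are total functions here; only their values on \<open>{Q<..}\<close> matter.\<close>

definition wsharp_bounds ::
    "('a::real_inner \<Rightarrow> 'a) \<Rightarrow> ('a \<Rightarrow> real) \<Rightarrow> nat \<Rightarrow> real \<Rightarrow> (real \<Rightarrow> real) \<Rightarrow> (real \<Rightarrow> real) \<Rightarrow> bool" where
  "wsharp_bounds F H r Q \<phi> \<Phi> \<longleftrightarrow>
     smooth_real_on {Q<..} \<phi> \<and> smooth_real_on {Q<..} \<Phi> \<and>
     (\<forall>h>Q. \<phi> h > 0 \<and> \<Phi> h > 0 \<and> \<phi> h \<le> (\<Phi> h)\<^sup>2) \<and>
     (\<forall>x. H x > Q \<longrightarrow>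
        \<bar>lie F H x\<bar> + (\<Sum>k = 2..r. \<bar>(lie F ^^ k) H x\<bar>\<^sup>2) \<ge> \<phi> (H x) \<and>
        (\<forall>k\<in>{1..r + 1}. \<bar>(lie F ^^ k) H x\<bar> \<le> \<Phi> (H x)))"

definition wsharp_B :: "nat \<Rightarrow> (real \<Rightarrow> real) \<Rightarrow> (real \<Rightarrow> real) \<Rightarrow> nat \<Rightarrow> real \<Rightarrow> real" where
  "wsharp_B r \<phi> \<Phi> k = (\<lambda>h. 2 ^ ((r - k) * (r - k + 1)) * ((\<Phi> h)\<^sup>2 / \<phi> h) ^ (r - k))"

definition wsharp_formula ::
    "('a::real_inner \<Rightarrow> 'a) \<Rightarrow> ('a \<Rightarrow> real) \<Rightarrow> nat \<Rightarrow> (real \<Rightarrow> real) \<Rightarrow> (real \<Rightarrow> real) \<Rightarrow> (real \<Rightarrow> real)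
      \<Rightarrow> 'a \<Rightarrow> real" where
  "wsharp_formula F H r \<phi> \<Phi> A x =
     A (H x) - (\<Sum>k = 2..r. wsharp_B r \<phi> \<Phi> k (H x) * (lie F ^^ (k - 1)) H x * (lie F ^^ k) H x)"

definition is_wsharp ::
    "('a::real_inner \<Rightarrow> 'a) \<Rightarrow> ('a \<Rightarrow> real) \<Rightarrow> nat \<Rightarrow> real \<Rightarrow> (real \<Rightarrow> real) \<Rightarrow> (real \<Rightarrow> real)
      \<Rightarrow> (real \<Rightarrow> real) \<Rightarrow> real \<Rightarrow> ('a \<Rightarrow> real) \<Rightarrow> bool" where
  "is_wsharp F H r Q \<phi> \<Phi> A \<epsilon> W \<longleftrightarrow>
     C1_smooth W \<and> (\<forall>x. H x > Q + \<epsilon> \<longrightarrow> W x = wsharp_formula F H r \<phi> \<Phi> A x)"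

text \<open>The last conjunct says that \<open>A\<close> grows fast enough at infinity to make \<open>W\<close> proper. If \<open>H\<close>
  is proper, it does not depend on \<open>\<epsilon>\<close> or on the extension \<open>W\<close>.\<close>

definition wsharp_A ::
    "('a::real_inner \<Rightarrow> 'a) \<Rightarrow> ('a \<Rightarrow> real) \<Rightarrow> nat \<Rightarrow> real \<Rightarrow> (real \<Rightarrow> real) \<Rightarrow> (real \<Rightarrow> real)
      \<Rightarrow> (real \<Rightarrow> real) \<Rightarrow> bool" where
  "wsharp_A F H r Q \<phi> \<Phi> A \<longleftrightarrow>
     smooth_real_on {Q<..} A \<and>
     (\<forall>h>Q. deriv A h > (\<Phi> h)\<^sup>2 * (\<Sum>k = 2..r. \<bar>deriv (wsharp_B r \<phi> \<Phi> k) h\<bar>)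
                         + \<Phi> h * wsharp_B r \<phi> \<Phi> 2 h + 1) \<and>
     (\<forall>\<epsilon>>0. \<forall>W. is_wsharp F H r Q \<phi> \<Phi> A \<epsilon> W \<longrightarrow> proper_fun W)"

end

(* The dissipation is L_F H = - p_1^2. If L_F H, ..., L_F^r H vanish at x, then p_1 is flat at t = 0
   along the trajectory through x. Newton's equation for p_j transports flatness of p_1, ..., p_j to
   V_j'(q_j - q_{j+1}), hence (V_j'' having at most simple zeros) to p_{j+1} at the cost of half of the
   order; r is chosen so that every p_j still vanishes to first order. So x is an equilibrium, and
   the growth of the U_j' confines the equilibria to a bounded set. In L_F W the squares
   B_k (L_F^k H)^2 absorb the mixed terms B_k L_F^{k-1} H L_F^{k+1} H because 4 B_k^2 = B_{k-1} B_{k+1},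
   and A' (L_F H) absorbs everything that carries a factor L_F H. *)
theory Submission
  imports Defs "HOL-Computational_Algebra.Formal_Power_Series"
begin

section \<open>Smooth functions on the line\<close>

text \<open>Two obstacles shape the proof. First, V_j'' may vanish at the point considered, so
  p_{j+1} cannot be solved for from p_1, ..., p_j. Lie derivatives are therefore collected in formal
  power series: f is sent to the sum of L_F^n f(x) t^n / n!, a ring homomorphism into an integral
  domain where orders of vanishing add, and no flow has to be constructed. If p_j vanishes through
  index m, the once differentiated Newton equation contains p_j'' (a loss of 2), and a simple zero
  of V_j'' turns 2 l + 1 into l. So m becomes (m - 3) / 2, that is, m + 3 is halved from site to
  site. Since L_F H = - p_1^2 vanishes through index r - 1 = 2 (3 * 2^N - 3), the order for p_1 is 3
  * 2^N - 3, and for p_j it is 3 * 2^(N+1-j) - 3. Second, phi, Phi and A must be smooth on (Q, oo)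
  although the quantities that they control may degenerate both near Q and at infinity. One
  principle supplies all of them: every locally bounded requirement on (Q, oo) has a smooth
  majorant, obtained by composing an everywhere convergent power series with (h - Q) + 1 / (h -
  Q).\<close>

lemma funpow_deriv_cong_open:
  assumes "open S" "\<And>x. x \<in> S \<Longrightarrow> f x = g x" "x \<in> S"
  shows "(deriv ^^ k) f x = (deriv ^^ k) (g :: real \<Rightarrow> real) x"
  using assms(3)
proof (induction k arbitrary: x)
  case (Suc k)
  have "eventually (\<lambda>y. (deriv ^^ k) f y = (deriv ^^ k) g y) (nhds x)"
    using Suc assms(1) by (auto simp: eventually_nhds)
  then show ?case by (simp add: deriv_cong_ev)
qed (use assms in auto)

lemma differentiable_cong_open:
  fixes f g :: "real \<Rightarrow> real"
  assumes "open S" "\<And>x. x \<in> S \<Longrightarrow> f x = g x" "x \<in> S" "g differentiable (at x)"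
  shows "f differentiable (at x)"
  using assms by (metis differentiable_def has_derivative_transform_within_open)

text \<open>Replaces formulas for k-th derivatives: exhibiting a class \<open>P\<close> stable under
  one differentiation is enough, because each \<open>(deriv ^^ k) f\<close> then agrees on
  \<open>S\<close> with a member of \<open>P\<close>. Agreement on \<open>S\<close> alone survives
  \<open>deriv\<close> since \<open>S\<close> is open.\<close>

lemma smooth_real_on_coinduct:
  assumes "open S" "P f"
    and step: "\<And>f. P f \<Longrightarrow> \<exists>g. P g \<and> (\<forall>x\<in>S. (f has_real_derivative g x) (at x))"
  shows "smooth_real_on S f"
proof -
  have "\<exists>g. P g \<and> (\<forall>x\<in>S. (deriv ^^ k) f x = g x)" for k
  proof (induction k)
    case (Suc k)
    then obtain g where g: "P g" "\<And>x. x \<in> S \<Longrightarrow> (deriv ^^ k) f x = g x" by blast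
    obtain g' where g': "P g'" "\<And>x. x \<in> S \<Longrightarrow> (g has_real_derivative g' x) (at x)"
      using step[OF g(1)] by blast
    have "(deriv ^^ Suc k) f x = g' x" if "x \<in> S" for x
    proof -
      have "(deriv ^^ Suc 0) ((deriv ^^ k) f) x = (deriv ^^ Suc 0) g x"
        by (rule funpow_deriv_cong_open[OF assms(1) g(2) that])
      then show ?thesis using g'(2)[OF that] by (simp add: DERIV_imp_deriv)
    qed
    then show ?case using g'(1) by blast
  qed (use assms in auto)
  then show ?thesis
    unfolding smooth_real_on_def
    by (metis assms(1) differentiable_cong_open real_differentiable_def step)
qed

lemma smooth_real_on_imp_DERIV:
  assumes "smooth_real_on S f" "x \<in> S"
  shows "(f has_real_derivative deriv f x) (at x)"
  using assms unfolding smooth_real_on_def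
  by (metis DERIV_deriv_iff_real_differentiable funpow_0)

lemma smooth_real_on_deriv:
  assumes "smooth_real_on S f"
  shows "smooth_real_on S (deriv f)"
  unfolding smooth_real_on_def
proof (intro allI ballI)
  fix k x assume "x \<in> S"
  then have "(deriv ^^ Suc k) f differentiable (at x)"
    using assms unfolding smooth_real_on_def by blast
  then show "(deriv ^^ k) (deriv f) differentiable (at x)"
    by (simp only: funpow_Suc_right o_apply)
qed

lemma smooth_real_on_continuous_on:
  "smooth_real_on S f \<Longrightarrow> continuous_on S f"
  by (meson DERIV_isCont continuous_at_imp_continuous_on smooth_real_on_imp_DERIV)

lemma smooth_real_on_antiderivative:
  assumes "open S" "smooth_real_on S g" "\<And>x. x \<in> S \<Longrightarrow> (f has_real_derivative g x) (at x)"
  shows "smooth_real_on S f"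
proof (rule smooth_real_on_coinduct[OF assms(1), where P = "\<lambda>h. smooth_real_on S h \<or> h = f"])
  fix h assume "smooth_real_on S h \<or> h = f"
  then show "\<exists>g. (smooth_real_on S g \<or> g = f) \<and> (\<forall>x\<in>S. (h has_real_derivative g x) (at x))"
    using assms smooth_real_on_deriv smooth_real_on_imp_DERIV by blast
qed auto

text \<open>The class fed to \<open>smooth_real_on_coinduct\<close>: by the product, quotient and
  chain rules it contains a derivative of each member. In \<open>compose\<close> the outer function
  is smooth on the whole line, so no condition on the range of \<open>f\<close> arises.\<close>

inductive smooth_closure :: "real set \<Rightarrow> (real \<Rightarrow> real) \<Rightarrow> bool" for S where
  base: "smooth_real_on S f \<Longrightarrow> smooth_closure S f"
| add: "smooth_closure S f \<Longrightarrow> smooth_closure S g \<Longrightarrow> smooth_closure S (\<lambda>x. f x + g x)"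
| mult: "smooth_closure S f \<Longrightarrow> smooth_closure S g \<Longrightarrow> smooth_closure S (\<lambda>x. f x * g x)"
| inverse: "smooth_closure S f \<Longrightarrow> \<forall>x\<in>S. f x \<noteq> 0 \<Longrightarrow> smooth_closure S (\<lambda>x. inverse (f x))"
| compose: "smooth_real_on UNIV h \<Longrightarrow> smooth_closure S f \<Longrightarrow> smooth_closure S (\<lambda>x. h (f x))"

lemma smooth_real_on_const: "smooth_real_on S (\<lambda>_. c)"
proof -
  have "smooth_real_on UNIV (\<lambda>_. c)"
    by (rule smooth_real_on_coinduct[where P = "\<lambda>f. \<exists>c. f = (\<lambda>_. c)"])
      (auto intro!: exI[of _ "\<lambda>_. 0"])
  then show ?thesis by (auto simp: smooth_real_on_def)
qed

lemma smooth_closure_imp_smooth: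
  assumes "open S" "smooth_closure S f"
  shows "smooth_real_on S f"
proof (rule smooth_real_on_coinduct[OF assms(1), where P = "smooth_closure S"])
  fix f assume "smooth_closure S f"
  then show "\<exists>g. smooth_closure S g \<and> (\<forall>x\<in>S. (f has_real_derivative g x) (at x))"
  proof induction
    case (base f)
    then show ?case
      using smooth_closure.base smooth_real_on_deriv smooth_real_on_imp_DERIV by blast
  next
    case (add f g)
    then obtain f' g' where "smooth_closure S f'" "smooth_closure S g'"
      "\<forall>x\<in>S. (f has_real_derivative f' x) (at x)" "\<forall>x\<in>S. (g has_real_derivative g' x) (at x)"
      by blast
    then show ?case
      by (intro exI[of _ "\<lambda>x. f' x + g' x"]) (auto intro: smooth_closure.add DERIV_add)
  next
    case (mult f g)
    then obtain f' g' where "smooth_closure S f'" "smooth_closure S g'"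
      "\<forall>x\<in>S. (f has_real_derivative f' x) (at x)" "\<forall>x\<in>S. (g has_real_derivative g' x) (at x)"
      by blast
    then show ?case using mult
      by (intro exI[of _ "\<lambda>x. f' x * g x + g' x * f x"])
        (auto intro!: smooth_closure.intros(2,3) DERIV_mult)
  next
    case (inverse f)
    then obtain f' where f': "smooth_closure S f'"
      "\<forall>x\<in>S. (f has_real_derivative f' x) (at x)" by blast
    have "smooth_closure S (\<lambda>x. (-1) * (inverse (f x) * f' x * inverse (f x)))"
      by (intro smooth_closure.mult smooth_closure.inverse f'(1) inverse(1,2)
          smooth_closure.base[OF smooth_real_on_const])
    moreover have "\<forall>x\<in>S. ((\<lambda>x. inverse (f x)) has_real_derivative
        (-1) * (inverse (f x) * f' x * inverse (f x))) (at x)"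
      using f' inverse DERIV_inverse' by fastforce
    ultimately show ?case by blast
  next
    case (compose h f)
    then obtain f' where f': "smooth_closure S f'"
      "\<forall>x\<in>S. (f has_real_derivative f' x) (at x)" by blast
    have "smooth_closure S (\<lambda>x. deriv h (f x) * f' x)"
      by (rule smooth_closure.mult[OF smooth_closure.compose[OF smooth_real_on_deriv]])
        (use compose f' in auto)
    moreover have "\<forall>x\<in>S. ((\<lambda>x. h (f x)) has_real_derivative deriv h (f x) * f' x) (at x)"
      using f'(2) DERIV_chain2[OF smooth_real_on_imp_DERIV[OF compose(1) UNIV_I]] by blast
    ultimately show ?case by blast
  qed
qed (use assms in auto)

lemma smooth_real_on_id: "open S \<Longrightarrow> smooth_real_on S (\<lambda>x. x)"
  by (rule smooth_real_on_antiderivative[OF _ smooth_real_on_const[where c = 1]]) auto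

lemma smooth_real_on_inverse:
  assumes "open S" "smooth_real_on S f" "\<And>x. x \<in> S \<Longrightarrow> f x \<noteq> 0"
  shows "smooth_real_on S (\<lambda>x. inverse (f x))"
  using assms by (intro smooth_closure_imp_smooth[OF _ smooth_closure.inverse[OF smooth_closure.base]]) auto

lemma smooth_real_on_add:
  assumes "open S" "smooth_real_on S f" "smooth_real_on S g"
  shows "smooth_real_on S (\<lambda>x. f x + g x)"
  using assms by (intro smooth_closure_imp_smooth[OF _ smooth_closure.add[OF smooth_closure.base smooth_closure.base]])

lemma smooth_real_on_compose:
  assumes "open S" "smooth_real_on UNIV h" "smooth_real_on S f"
  shows "smooth_real_on S (\<lambda>x. h (f x))"
  by (rule smooth_closure_imp_smooth[OF assms(1)
        smooth_closure.compose[OF assms(2) smooth_closure.base[OF assms(3)]]])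

section \<open>Smooth functions of arbitrarily fast growth\<close>

lemma smooth_real_on_everywhere_convergent_series:
  fixes c :: "nat \<Rightarrow> real"
  assumes "\<And>y. summable (\<lambda>n. c n * y ^ n)"
  shows "smooth_real_on UNIV (\<lambda>y. \<Sum>n. c n * y ^ n)"
proof (rule smooth_real_on_coinduct[where P = "\<lambda>f. \<exists>c::nat \<Rightarrow> real.
    (\<forall>y. summable (\<lambda>n. c n * y ^ n)) \<and> f = (\<lambda>y. \<Sum>n. c n * y ^ n)"])
  fix f :: "real \<Rightarrow> real"
  assume "\<exists>c. (\<forall>y. summable (\<lambda>n. c n * y ^ n)) \<and> f = (\<lambda>y. \<Sum>n. c n * y ^ n)"
  then obtain c where c: "\<And>y. summable (\<lambda>n. c n * y ^ n)" "f = (\<lambda>y. \<Sum>n. c n * y ^ n)"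
    by blast
  show "\<exists>g. (\<exists>c. (\<forall>y. summable (\<lambda>n. c n * y ^ n)) \<and> g = (\<lambda>y. \<Sum>n. c n * y ^ n)) \<and>
      (\<forall>x\<in>UNIV. (f has_real_derivative g x) (at x))"
    using termdiff_converges_all[OF c(1)] termdiffs_strong_converges_everywhere[OF c(1)] c(2)
    by blast
qed (use assms in auto)

text \<open>A series \<open>\<Sum>m. (2 y / \<nu> m)\<^sup>m\<close> with \<open>\<nu> \<longlonglongrightarrow> \<infinity>\<close> converges everywhere, and \<open>\<nu>\<close> may grow
  as slowly as we like, so the sum grows as fast as we like.\<close>

lemma smooth_majorant_of_sequence:
  fixes G :: "nat \<Rightarrow> real"
  obtains E where "smooth_real_on UNIV E" "\<And>n t. real (n + 1) \<le> t \<Longrightarrow> G n \<le> E t"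
proof -
  \<comment> \<open>Summing makes \<open>k\<close> strictly increasing, so that it can be inverted
    by counting, while \<open>2 ^ k n\<close> still dominates \<open>G n\<close>.\<close>
  define k where "k n = (\<Sum>i\<le>n. nat \<lceil>\<bar>G i\<bar>\<rceil> + 1)" for n
  have mono: "strict_mono k" by (rule strict_monoI_Suc) (simp add: k_def)
  have kG: "G n \<le> 2 ^ k n" for n
  proof -
    have "nat \<lceil>\<bar>G n\<bar>\<rceil> + 1 \<le> k n"
      unfolding k_def by (rule member_le_sum) auto
    then have "G n \<le> real (k n)" by linarith
    also have "\<dots> \<le> 2 ^ k n" by (simp add: of_nat_less_two_power less_imp_le)
    finally show ?thesis .
  qed
  \<comment> \<open>A slowly growing inverse of \<open>k\<close>, with
    \<open>\<nu> (k n) = n + 1\<close>. For \<open>t \<ge> n + 1\<close> the single term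
    \<open>m = k n\<close> of the series is then at least \<open>2 ^ k n\<close>, and the other
    terms are nonnegative.\<close>
  define \<nu> where "\<nu> m = card {i. k i < m} + 1" for m
  have fin: "finite {i. k i < m}" for m
    by (rule finite_subset[of _ "{..<m}"])
      (use mono seq_suble[of k] in \<open>auto intro: le_less_trans\<close>)
  have \<nu>k: "\<nu> (k n) = n + 1" for n
    by (simp add: \<nu>_def strict_mono_less[OF mono] flip: lessThan_def)
  have \<nu>_ge: "\<nu> m \<ge> n" if "m \<ge> k n" for n m
  proof -
    have "card {..<n} \<le> card {i. k i < m}"
      by (rule card_mono[OF fin]) (use that mono in \<open>auto simp: strict_mono_def intro: less_le_trans\<close>)
    then show ?thesis by (simp add: \<nu>_def)
  qed
  define c where "c m = (2 / real (\<nu> m)) ^ m" for m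
  have c_nonneg: "c m \<ge> 0" for m by (simp add: c_def)
  have sm: "summable (\<lambda>m. c m * y ^ m)" for y
  proof -
    \<comment> \<open>From index \<open>k n\<close> on,
      \<open>\<nu> m \<ge> n \<ge> 4 * \<bar>y\<bar>\<close>, so the terms are dominated by a
      geometric series of ratio 1/2.\<close>
    define n where "n = nat \<lceil>4 * \<bar>y\<bar>\<rceil> + 1"
    have "norm (c m * y ^ m) \<le> (1/2) ^ m" if "m \<ge> k n" for m
    proof -
      have "real (\<nu> m) \<ge> 4 * \<bar>y\<bar>" "real (\<nu> m) > 0"
        using \<nu>_ge[OF that] unfolding n_def by linarith+
      then have "2 / real (\<nu> m) * \<bar>y\<bar> \<le> 1/2" by (simp add: field_simps)
      then have "(2 / real (\<nu> m) * \<bar>y\<bar>) ^ m \<le> (1/2) ^ m" by (intro power_mono) auto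
      moreover have "norm (c m * y ^ m) = (2 / real (\<nu> m) * \<bar>y\<bar>) ^ m"
        by (simp only: real_norm_def abs_mult power_abs power_mult_distrib c_def) simp
      ultimately show ?thesis by simp
    qed
    then show ?thesis by (intro summable_comparison_test[OF _ summable_geometric[of "1/2"]]) auto
  qed
  show thesis
  proof
    show "smooth_real_on UNIV (\<lambda>y. \<Sum>m. c m * y ^ m)"
      by (rule smooth_real_on_everywhere_convergent_series[OF sm])
    fix n t assume t: "real (n + 1) \<le> t"
    then have "2 \<le> 2 / real (n + 1) * t" by (simp add: field_simps)
    then have "2 ^ k n \<le> (2 / real (n + 1) * t) ^ k n" by (intro power_mono) auto
    also have "\<dots> = c (k n) * t ^ k n" by (simp only: c_def \<nu>k power_mult_distrib)
    also have "\<dots> \<le> (\<Sum>m. c m * t ^ m)"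
    proof -
      have "sum (\<lambda>m. c m * t ^ m) {k n} \<le> (\<Sum>m. c m * t ^ m)"
        by (rule sum_le_suminf[OF sm]) (use t c_nonneg in auto)
      then show ?thesis by simp
    qed
    finally show "G n \<le> (\<Sum>m. c m * t ^ m)" using kG[of n] by simp
  qed
qed

text \<open>The function \<open>s h = (h - Q) + 1 / (h - Q)\<close> exhausts the open half-line: an
  upper bound on \<open>s h\<close> confines \<open>h\<close> to a compact interval inside it, where
  \<open>bdd\<close> applies. One bound per integer level is a sequence \<open>G\<close>, dominated
  by a smooth \<open>E\<close>, and \<open>E (s h)\<close> is the majorant.\<close>

lemma smooth_majorant:
  fixes S :: "real \<Rightarrow> real set"
  assumes bdd: "\<And>a b. Q < a \<Longrightarrow> \<exists>B. \<forall>h\<in>{a..b}. \<forall>y\<in>S h. y \<le> B"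
  obtains \<Psi> where "smooth_real_on {Q<..} \<Psi>" "\<And>h y. Q < h \<Longrightarrow> y \<in> S h \<Longrightarrow> y \<le> \<Psi> h"
proof -
  define s where "s h = (h + (- Q)) + inverse (h + (- Q))" for h
  have "\<exists>B. \<forall>h>Q. s h \<le> real n + 2 \<longrightarrow> (\<forall>y\<in>S h. y \<le> B)" for n
  proof -
    obtain B where B: "\<forall>h\<in>{Q + 1 / (real n + 2)..Q + (real n + 2)}. \<forall>y\<in>S h. y \<le> B"
      using bdd[of "Q + 1 / (real n + 2)" "Q + (real n + 2)"] by auto
    have "h \<in> {Q + 1 / (real n + 2)..Q + (real n + 2)}" if "h > Q" "s h \<le> real n + 2" for h
    proof -
      have pos: "h - Q > 0" "inverse (h - Q) > 0" using that by auto
      have 1: "h - Q \<le> real n + 2" "inverse (h - Q) \<le> real n + 2"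
        using that(2) pos unfolding s_def diff_conv_add_uminus[symmetric] by linarith+
      have "1 / (real n + 2) \<le> h - Q" using 1(2) pos by (simp add: field_simps)
      then show ?thesis using 1 by auto
    qed
    then show ?thesis using B by blast
  qed
  then obtain G where G: "\<And>n h y. h > Q \<Longrightarrow> s h \<le> real n + 2 \<Longrightarrow> y \<in> S h \<Longrightarrow> y \<le> G n"
    by metis
  obtain E where E: "smooth_real_on UNIV E" "\<And>n t. real (n + 1) \<le> t \<Longrightarrow> G n \<le> E t"
    using smooth_majorant_of_sequence by blast
  have shift: "smooth_real_on {Q<..} (\<lambda>h. h + (- Q))"
    by (rule smooth_real_on_add[OF _ smooth_real_on_id smooth_real_on_const]) auto
  have "smooth_real_on {Q<..} s"
    unfolding s_def by (rule smooth_real_on_add[OF _ shift smooth_real_on_inverse[OF _ shift]]) auto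
  then have "smooth_real_on {Q<..} (\<lambda>h. E (s h))"
    by (intro smooth_real_on_compose[OF _ E(1)]) auto
  moreover have "y \<le> E (s h)" if "Q < h" "y \<in> S h" for h y
  proof -
    have "s h > 0" using that by (simp add: s_def add_pos_pos)
    moreover have "s h \<ge> 1"
    proof (cases "h - Q \<ge> 1")
      case True
      moreover have "inverse (h - Q) > 0" using that by auto
      ultimately show ?thesis unfolding s_def diff_conv_add_uminus[symmetric] by linarith
    next
      case False
      then have "1 \<le> inverse (h - Q)" using that by (simp add: field_simps)
      moreover have "h - Q > 0" using that by simp
      ultimately show ?thesis unfolding s_def diff_conv_add_uminus[symmetric] by linarith
    qed
    \<comment> \<open>As \<open>s h \<ge> 1\<close>, the truncated subtraction is harmless;
      \<open>n + 1 \<le> s h \<le> n + 2\<close> meets both the range where \<open>E\<close>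
      dominates \<open>G n\<close> and the level where \<open>G n\<close> bounds
      \<open>S h\<close>.\<close>
    define n where "n = nat \<lfloor>s h\<rfloor> - 1"
    have "nat \<lfloor>s h\<rfloor> \<ge> 1" using \<open>s h \<ge> 1\<close> by linarith
    then have n: "real n + 1 \<le> s h" "s h \<le> real n + 2"
      unfolding n_def using \<open>s h \<ge> 1\<close> by linarith+
    show ?thesis using G[OF that(1) n(2) that(2)] E(2)[of n "s h"] n by simp
  qed
  ultimately show thesis using that by blast
qed

section \<open>Antiderivatives and C1 extensions on the line\<close>

lemma antiderivative_on_greaterThan:
  fixes g :: "real \<Rightarrow> real"
  assumes "continuous_on {Q<..} g"
  obtains f where "\<And>x. Q < x \<Longrightarrow> (f has_real_derivative g x) (at x)"
proof -
  have "\<exists>F. \<forall>x. ereal Q < ereal x \<longrightarrow> ereal x < \<infinity> \<longrightarrow> (F has_vector_derivative g x) (at x)"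
    by (rule einterval_antiderivative)
      (use assms in \<open>auto simp: continuous_on_eq_continuous_at\<close>)
  then show thesis using that by (auto simp: has_real_derivative_iff_has_vector_derivative)
qed

text \<open>Freezing the derivative at its value at \<open>c\<close> extends it continuously to the
  whole line; integrating gives an extension that is affine to the left of \<open>c\<close>.\<close>

lemma C1_extension:
  fixes f f' :: "real \<Rightarrow> real"
  assumes "Q < c" "\<And>x. Q < x \<Longrightarrow> (f has_real_derivative f' x) (at x)" "continuous_on {Q<..} f'"
  obtains g g' where "\<And>x. (g has_real_derivative g' x) (at x)" "continuous_on UNIV g'"
    "\<And>x. c < x \<Longrightarrow> g x = f x"
proof -
  define g' where "g' x = f' (max x c)" for x
  have cont: "continuous_on UNIV g'"
    unfolding g'_def
    by (rule continuous_on_compose2[OF assms(3)]) (use assms in \<open>auto intro!: continuous_intros\<close>)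
  have "\<exists>F. \<forall>x. -\<infinity> < ereal x \<longrightarrow> ereal x < \<infinity> \<longrightarrow> (F has_vector_derivative g' x) (at x)"
    by (rule einterval_antiderivative) (use cont in \<open>auto simp: continuous_on_eq_continuous_at\<close>)
  then obtain G where G: "\<And>x. (G has_real_derivative g' x) (at x)"
    by (auto simp: has_real_derivative_iff_has_vector_derivative)
  define g where "g x = G x - (G c - f c)" for x
  have g: "(g has_real_derivative g' x) (at x)" for x
    unfolding g_def by (auto intro!: derivative_eq_intros G)
  have "g x = f x" if "c < x" for x
  proof -
    have "(\<lambda>y. g y - f y) x = (\<lambda>y. g y - f y) c"
    proof (rule DERIV_isconst2[OF that])
      show "continuous_on {c..x} (\<lambda>y. g y - f y)"
        by (intro continuous_on_diff continuous_at_imp_continuous_on ballI DERIV_isCont[OF g]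
            DERIV_isCont[OF assms(2)]) (use assms in auto)
      show "((\<lambda>y. g y - f y) has_real_derivative 0) (at y)" if "c < y" "y < x" for y
        using DERIV_diff[OF g assms(2), of y] that assms(1) by (simp add: g'_def max_def)
    qed (use that in auto)
    then show ?thesis by (simp add: g_def)
  qed
  then show thesis using that g cont by blast
qed

section \<open>Lie derivatives of smooth functions\<close>

lemma GDERIV_unique:
  assumes "GDERIV f x :> g" "GDERIV f x :> g'"
  shows "g = g'"
proof -
  have "(\<lambda>h. h \<bullet> g) = (\<lambda>h. h \<bullet> g')"
    using assms has_derivative_unique unfolding gderiv_def by blast
  then have "(g - g') \<bullet> (g - g') = 0"
    by (metis cancel_comm_monoid_add_class.diff_cancel inner_diff_right)
  then show ?thesis by simp
qed

lemma grad_eq: "GDERIV f x :> g \<Longrightarrow> grad f x = g"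
  unfolding grad_def by (blast intro: GDERIV_unique)

lemma GDERIV_sum:
  assumes "\<And>i. i \<in> I \<Longrightarrow> GDERIV (f i) x :> g i"
  shows "GDERIV (\<lambda>x. \<Sum>i\<in>I. f i x) x :> (\<Sum>i\<in>I. g i)"
  using assms by (induction I rule: infinite_finite_induct) (auto intro: GDERIV_const GDERIV_add)

lemma GDERIV_isCont: "GDERIV f x :> g \<Longrightarrow> isCont f x"
  unfolding gderiv_def using has_derivative_continuous by blast

lemma C1_smooth_grad:
  assumes "C1_smooth f"
  shows "GDERIV f x :> grad f x"
  using assms grad_eq unfolding C1_smooth_def by metis

lemma C1_smooth_continuous_on: "C1_smooth f \<Longrightarrow> continuous_on S f"
  using C1_smooth_grad GDERIV_isCont continuous_at_imp_continuous_on by blast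

text \<open>The algebra generated by the coordinates and closed under composition with smooth real
  functions. It is closed under Lie derivatives along vector fields with components in it, so that
  iterated Lie derivatives need no theory of higher derivatives in several variables.\<close>

inductive smooth_fun :: "('a::euclidean_space \<Rightarrow> real) \<Rightarrow> bool" where
  const: "smooth_fun (\<lambda>_. c)"
| coord: "smooth_fun (\<lambda>x. x \<bullet> b)"
| add: "smooth_fun f \<Longrightarrow> smooth_fun g \<Longrightarrow> smooth_fun (\<lambda>x. f x + g x)"
| mult: "smooth_fun f \<Longrightarrow> smooth_fun g \<Longrightarrow> smooth_fun (\<lambda>x. f x * g x)"
| compose: "smooth_real_on UNIV h \<Longrightarrow> smooth_fun f \<Longrightarrow> smooth_fun (\<lambda>x. h (f x))"

lemma smooth_fun_gradient:
  assumes "smooth_fun f"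
  shows "\<exists>g. (\<forall>x. GDERIV f x :> g x) \<and> (\<forall>b. smooth_fun (\<lambda>x. g x \<bullet> b))"
  using assms
proof induction
  case (const c)
  show ?case using smooth_fun.const[of 0] by (intro exI[of _ "\<lambda>_. 0"]) (simp add: GDERIV_const)
next
  case (coord b)
  have "GDERIV (\<lambda>x. x \<bullet> b) x :> b" for x
    unfolding gderiv_def by (auto intro!: derivative_eq_intros)
  then show ?case using smooth_fun.const by (intro exI[of _ "\<lambda>_. b"]) blast
next
  case (add f g)
  then obtain f' g' where "\<forall>x. GDERIV f x :> f' x" "\<forall>b. smooth_fun (\<lambda>x. f' x \<bullet> b)"
    "\<forall>x. GDERIV g x :> g' x" "\<forall>b. smooth_fun (\<lambda>x. g' x \<bullet> b)" by blast
  then show ?case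
    by (intro exI[of _ "\<lambda>x. f' x + g' x"]) (auto intro: GDERIV_add smooth_fun.add simp: inner_add_left)
next
  case (mult f g)
  then obtain f' g' where "\<forall>x. GDERIV f x :> f' x" "\<forall>b. smooth_fun (\<lambda>x. f' x \<bullet> b)"
    "\<forall>x. GDERIV g x :> g' x" "\<forall>b. smooth_fun (\<lambda>x. g' x \<bullet> b)" by blast
  then show ?case using mult(1,2)
    by (intro exI[of _ "\<lambda>x. f x *\<^sub>R g' x + g x *\<^sub>R f' x"])
      (simp add: GDERIV_mult smooth_fun.add smooth_fun.mult inner_add_left)
next
  case (compose h f)
  then obtain f' where f': "\<forall>x. GDERIV f x :> f' x" "\<forall>b. smooth_fun (\<lambda>x. f' x \<bullet> b)" by blast
  have "smooth_fun (\<lambda>x. deriv h (f x) * (f' x \<bullet> b))" for b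
    using smooth_fun.mult[OF smooth_fun.compose[OF smooth_real_on_deriv[OF compose(1)] compose(2)]]
      f'(2) by blast
  moreover have "GDERIV (\<lambda>x. h (f x)) x :> deriv h (f x) *\<^sub>R f' x" for x
    using GDERIV_DERIV_compose[OF _ smooth_real_on_imp_DERIV[OF compose(1) UNIV_I]] f'(1) by blast
  ultimately show ?case by (intro exI[of _ "\<lambda>x. deriv h (f x) *\<^sub>R f' x"]) simp
qed

lemma smooth_fun_GDERIV: "smooth_fun f \<Longrightarrow> GDERIV f x :> grad f x"
  using smooth_fun_gradient grad_eq by metis

lemma smooth_fun_grad_coord: "smooth_fun f \<Longrightarrow> smooth_fun (\<lambda>x. grad f x \<bullet> b)"
proof -
  assume "smooth_fun f"
  then obtain g where g: "\<forall>x. GDERIV f x :> g x" "\<forall>b. smooth_fun (\<lambda>x. g x \<bullet> b)"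
    using smooth_fun_gradient by blast
  then have "grad f = g" using grad_eq by blast
  then show ?thesis using g by simp
qed

lemma smooth_fun_continuous_on: "smooth_fun f \<Longrightarrow> continuous_on S f"
  using smooth_fun_GDERIV GDERIV_isCont continuous_at_imp_continuous_on by blast

lemma smooth_fun_continuous_on_grad: "smooth_fun f \<Longrightarrow> continuous_on S (grad f)"
  by (subst continuous_on_componentwise) (blast intro: smooth_fun_continuous_on smooth_fun_grad_coord)

lemma smooth_fun_imp_C1_smooth: "smooth_fun f \<Longrightarrow> C1_smooth f"
  unfolding C1_smooth_def using smooth_fun_GDERIV smooth_fun_continuous_on_grad by blast

lemma smooth_fun_minus: "smooth_fun f \<Longrightarrow> smooth_fun (\<lambda>x. - f x)"
  using smooth_fun.mult[OF smooth_fun.const[of "-1"]] by simp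

lemma smooth_fun_diff: "smooth_fun f \<Longrightarrow> smooth_fun g \<Longrightarrow> smooth_fun (\<lambda>x. f x - g x)"
  using smooth_fun.add[OF _ smooth_fun_minus] by simp

lemma smooth_fun_sum:
  assumes "\<And>i. i \<in> I \<Longrightarrow> smooth_fun (f i)"
  shows "smooth_fun (\<lambda>x. \<Sum>i\<in>I. f i x)"
  using assms by (induction I rule: infinite_finite_induct) (auto intro: smooth_fun.const smooth_fun.add)

definition smooth_field :: "('a::euclidean_space \<Rightarrow> 'a) \<Rightarrow> bool" where
  "smooth_field F \<longleftrightarrow> (\<forall>b\<in>Basis. smooth_fun (\<lambda>x. F x \<bullet> b))"

lemma smooth_fun_lie:
  assumes "smooth_field F" "smooth_fun f"
  shows "smooth_fun (lie F f)"
proof -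
  have "lie F f = (\<lambda>x. \<Sum>b\<in>Basis. (grad f x \<bullet> b) * (F x \<bullet> b))"
    unfolding lie_def by (simp add: euclidean_inner[symmetric])
  then show ?thesis
    using assms by (auto intro!: smooth_fun_sum smooth_fun.mult smooth_fun_grad_coord
        simp: smooth_field_def)
qed

lemma smooth_fun_lie_funpow:
  assumes "smooth_field F" "smooth_fun f"
  shows "smooth_fun ((lie F ^^ n) f)"
  by (induction n) (auto intro: assms smooth_fun_lie)

lemma lie_eq: "GDERIV f x :> g \<Longrightarrow> lie F f x = g \<bullet> F x"
  by (simp add: lie_def grad_eq)

lemma lie_const: "lie F (\<lambda>_. c) x = 0"
  using lie_eq[OF GDERIV_const] by simp

lemma lie_add:
  "smooth_fun f \<Longrightarrow> smooth_fun g \<Longrightarrow> lie F (\<lambda>x. f x + g x) x = lie F f x + lie F g x"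
  using lie_eq[OF GDERIV_add[OF smooth_fun_GDERIV smooth_fun_GDERIV]]
  by (simp add: lie_def inner_add_left)

lemma lie_diff:
  "smooth_fun f \<Longrightarrow> smooth_fun g \<Longrightarrow> lie F (\<lambda>x. f x - g x) x = lie F f x - lie F g x"
  using lie_eq[OF GDERIV_diff[OF smooth_fun_GDERIV smooth_fun_GDERIV]]
  by (simp add: lie_def inner_diff_left)

lemma lie_mult:
  "smooth_fun f \<Longrightarrow> smooth_fun g \<Longrightarrow>
    lie F (\<lambda>x. f x * g x) x = f x * lie F g x + g x * lie F f x"
  using lie_eq[OF GDERIV_mult[OF smooth_fun_GDERIV smooth_fun_GDERIV]]
  by (simp add: lie_def inner_add_left)

lemma lie_compose:
  assumes "smooth_real_on UNIV h" "smooth_fun f"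
  shows "lie F (\<lambda>x. h (f x)) x = deriv h (f x) * lie F f x"
  using lie_eq[OF GDERIV_DERIV_compose[OF smooth_fun_GDERIV[OF assms(2)]
        smooth_real_on_imp_DERIV[OF assms(1) UNIV_I]]]
  by (simp add: lie_def)

lemma lie_sum:
  assumes "\<And>i. i \<in> I \<Longrightarrow> smooth_fun (f i)"
  shows "lie F (\<lambda>x. \<Sum>i\<in>I. f i x) x = (\<Sum>i\<in>I. lie F (f i) x)"
  using lie_eq[OF GDERIV_sum[OF smooth_fun_GDERIV[OF assms]]]
  by (simp add: lie_def inner_sum_left)

section \<open>Taylor series along trajectories\<close>

text \<open>The formal Taylor series at \<open>t = 0\<close> of \<open>f\<close> along the trajectory of \<open>F\<close> through \<open>x\<close>.\<close>

definition lie_series :: "('a::euclidean_space \<Rightarrow> 'a) \<Rightarrow> 'a \<Rightarrow> ('a \<Rightarrow> real) \<Rightarrow> real fps" where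
  "lie_series F x f = Abs_fps (\<lambda>n. (lie F ^^ n) f x / fact n)"

lemma lie_series_nth: "fps_nth (lie_series F x f) n = (lie F ^^ n) f x / fact n"
  by (simp add: lie_series_def)

text \<open>Division by \<open>fact n\<close> turns the passage from \<open>f\<close> to
  \<open>lie F f\<close> into formal differentiation in time; sums and products of series are
  treated through this rule.\<close>

lemma lie_series_lie: "lie_series F x (lie F f) = fps_deriv (lie_series F x f)"
  by (rule fps_ext) (simp add: lie_series_nth funpow_swap1 nonzero_divide_mult_cancel_left del: of_nat_Suc of_nat_add)

text \<open>Characteristic zero: the factor \<open>n + 1\<close> produced by
  \<open>fps_deriv\<close> cancels. It drives the inductions on the coefficient index.\<close>

lemma fps_eq_if_deriv_nth_eq:
  fixes a b :: "real fps"
  assumes "fps_nth (fps_deriv a) n = fps_nth (fps_deriv b) n"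
  shows "fps_nth a (Suc n) = fps_nth b (Suc n)"
  using assms by (simp del: of_nat_Suc of_nat_add add: add.commute)

lemma lie_series_add:
  assumes F: "smooth_field F" and "smooth_fun f" "smooth_fun g"
  shows "lie_series F x (\<lambda>x. f x + g x) = lie_series F x f + lie_series F x g"
proof (rule fps_ext)
  fix n show "fps_nth (lie_series F x (\<lambda>x. f x + g x)) n = fps_nth (lie_series F x f + lie_series F x g) n"
    using assms(2,3)
  proof (induction n arbitrary: f g)
    case (Suc n)
    have "lie F (\<lambda>x. f x + g x) = (\<lambda>x. lie F f x + lie F g x)"
      using Suc.prems lie_add by blast
    then have "fps_nth (fps_deriv (lie_series F x (\<lambda>x. f x + g x))) n
        = fps_nth (fps_deriv (lie_series F x f + lie_series F x g)) n"
      using Suc smooth_fun_lie[OF F] by (simp add: fps_deriv_add flip: lie_series_lie)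
    then show ?case by (rule fps_eq_if_deriv_nth_eq)
  qed (simp add: lie_series_nth)
qed

text \<open>The Leibniz rule in all orders at once: the constant terms agree, and coefficient
  \<open>n + 1\<close> is compared through coefficient \<open>n\<close> of the formal derivatives.
  The induction varies \<open>f\<close> and \<open>g\<close> because differentiation replaces one
  factor by its Lie derivative.\<close>

lemma lie_series_mult:
  assumes F: "smooth_field F" and "smooth_fun f" "smooth_fun g"
  shows "lie_series F x (\<lambda>x. f x * g x) = lie_series F x f * lie_series F x g"
proof (rule fps_ext)
  fix n show "fps_nth (lie_series F x (\<lambda>x. f x * g x)) n = fps_nth (lie_series F x f * lie_series F x g) n"
    using assms(2,3)
  proof (induction n arbitrary: f g)
    case (Suc n)
    have "lie F (\<lambda>x. f x * g x) = (\<lambda>x. f x * lie F g x + g x * lie F f x)"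
      using Suc.prems lie_mult by blast
    then have "fps_nth (fps_deriv (lie_series F x (\<lambda>x. f x * g x))) n
        = fps_nth (lie_series F x (\<lambda>x. f x * lie F g x)) n + fps_nth (lie_series F x (\<lambda>x. g x * lie F f x)) n"
      using lie_series_add[OF F smooth_fun.mult smooth_fun.mult] Suc.prems smooth_fun_lie[OF F]
      by (simp flip: lie_series_lie)
    also have "\<dots> = fps_nth (lie_series F x f * lie_series F x (lie F g)
        + lie_series F x g * lie_series F x (lie F f)) n"
      using Suc smooth_fun_lie[OF F] by simp
    also have "\<dots> = fps_nth (fps_deriv (lie_series F x f * lie_series F x g)) n"
      by (simp only: lie_series_lie fps_deriv_mult) (simp add: algebra_simps)
    finally show ?case by (rule fps_eq_if_deriv_nth_eq)
  qed (simp add: lie_series_nth)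
qed

lemma lie_series_const: "lie_series F x (\<lambda>_. c) = fps_const c"
proof (rule fps_ext)
  fix n
  have "lie F (\<lambda>_. c) = (\<lambda>_. 0)" for c :: real using lie_const by blast
  then have "(lie F ^^ k) (\<lambda>_. 0) = (\<lambda>_. 0)" "(lie F ^^ Suc k) (\<lambda>_. c) = (\<lambda>_. 0)" for k
    by (induction k) auto
  then show "fps_nth (lie_series F x (\<lambda>_. c)) n = fps_nth (fps_const c) n"
    by (cases n) (auto simp: lie_series_nth)
qed

lemma lie_series_minus:
  assumes "smooth_field F" "smooth_fun f"
  shows "lie_series F x (\<lambda>x. - f x) = - lie_series F x f"
proof -
  have "lie_series F x (\<lambda>x. f x + - f x) = lie_series F x f + lie_series F x (\<lambda>x. - f x)"
    by (rule lie_series_add[OF assms smooth_fun_minus[OF assms(2)]])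
  then show ?thesis by (simp add: lie_series_const eq_neg_iff_add_eq_0 add.commute)
qed

lemma lie_series_diff:
  assumes "smooth_field F" "smooth_fun f" "smooth_fun g"
  shows "lie_series F x (\<lambda>x. f x - g x) = lie_series F x f - lie_series F x g"
  using lie_series_add[OF assms(1,2) smooth_fun_minus[OF assms(3)]] lie_series_minus[OF assms(1,3)]
  by simp

section \<open>Orders of vanishing of formal power series\<close>

definition vanishes_to :: "real fps \<Rightarrow> nat \<Rightarrow> bool" where
  "vanishes_to a m \<longleftrightarrow> (\<forall>i\<le>m. fps_nth a i = 0)"

lemma vanishes_to_mono: "vanishes_to a m \<Longrightarrow> n \<le> m \<Longrightarrow> vanishes_to a n"
  by (auto simp: vanishes_to_def)

lemma vanishes_to_0: "vanishes_to 0 m"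
  by (auto simp: vanishes_to_def)

text \<open>The index \<open>m\<close> is included, hence the strict inequality; the zero series is
  a separate case because \<open>subdegree 0 = 0\<close>.\<close>

lemma vanishes_to_iff: "vanishes_to a m \<longleftrightarrow> a = 0 \<or> m < subdegree a"
  by (metis le_less_linear linorder_not_less nth_less_subdegree_zero nth_subdegree_nonzero order.strict_trans1 vanishes_to_0 vanishes_to_def)

lemma vanishes_to_diff: "vanishes_to a m \<Longrightarrow> vanishes_to b m \<Longrightarrow> vanishes_to (a - b) m"
  by (auto simp: vanishes_to_def)

lemma vanishes_to_mult: "vanishes_to a m \<Longrightarrow> vanishes_to (b * a) m"
  by (cases "a = 0"; cases "b = 0") (auto simp: vanishes_to_iff subdegree_mult)

lemma vanishes_to_deriv: "vanishes_to a (Suc m) \<Longrightarrow> vanishes_to (fps_deriv a) m"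
  by (auto simp: vanishes_to_def)

text \<open>Orders double under squaring; this passes from the dissipation \<open>p 1 * p 1\<close>
  to \<open>p 1\<close>.\<close>

lemma vanishes_to_square:
  assumes "vanishes_to (a * a) (2 * m)"
  shows "vanishes_to a m"
  using assms by (cases "a = 0") (auto simp: vanishes_to_iff subdegree_mult)

lemma vanishes_to_unit_mult:
  assumes "vanishes_to (a * b) m" "fps_nth a 0 \<noteq> 0"
  shows "vanishes_to b m"
  using assms by (cases "a = 0"; cases "b = 0") (auto simp: vanishes_to_iff subdegree_mult)

text \<open>As \<open>c\<close> is a unit and \<open>a\<close> has no constant term, the order of
  \<open>a\<close> is that of its derivative plus one, so the order of \<open>b\<close> plus one.
  Hence \<open>a * b\<close> has order twice that of \<open>b\<close> plus one: the halving at a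
  simple zero.\<close>

lemma vanishes_to_fold:
  assumes "fps_nth a 0 = 0" "fps_deriv a = c * b" "fps_nth c 0 \<noteq> 0"
    and "vanishes_to (a * b) (2 * l + 1)"
  shows "vanishes_to b l"
proof (cases "b = 0")
  case False
  have "c \<noteq> 0" using assms(3) by auto
  then have "a \<noteq> 0" using assms(2) False by auto
  then have pos: "subdegree a > 0" using assms(1) using \<open>a \<noteq> 0\<close>
    by (metis gr0I nth_subdegree_nonzero)
  have "subdegree (fps_deriv a) = subdegree b"
    unfolding assms(2) using assms(3) by (simp add: False \<open>c \<noteq> 0\<close>)
  moreover have "subdegree a = Suc (subdegree (fps_deriv a))"
  proof -
    obtain n where n: "subdegree a = Suc n" using pos gr0_implies_Suc by blast
    have "subdegree (fps_deriv a) = n"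
    proof (rule subdegreeI)
      have "fps_nth a (n + 1) \<noteq> 0" using nth_subdegree_nonzero[OF \<open>a \<noteq> 0\<close>] unfolding n by simp
      then show "fps_nth (fps_deriv a) n \<noteq> 0"
        unfolding fps_deriv_nth by (rule no_zero_divisors[rotated]) (simp del: of_nat_add)
      show "fps_nth (fps_deriv a) i = 0" if "i < n" for i
        using nth_less_subdegree_zero[of "i + 1" a] n that by (simp add: fps_deriv_nth)
    qed
    then show ?thesis using n by simp
  qed
  ultimately have "subdegree a = Suc (subdegree b)" by simp
  then show ?thesis using assms(4) False \<open>a \<noteq> 0\<close> by (auto simp: vanishes_to_iff subdegree_mult)
qed (simp add: vanishes_to_0)

text \<open>If \<open>g'\<close> has at most simple zeros, then flatness of \<open>g \<circ> u\<close> gives flatness of \<open>u\<close> at the cost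
  of half of the order.\<close>

lemma lie_series_compose_vanishes:
  assumes F: "smooth_field F" and u: "smooth_fun u" and g: "smooth_real_on UNIV g"
    and nondeg: "deriv g (u x) \<noteq> 0 \<or> deriv (deriv g) (u x) \<noteq> 0"
    and van: "vanishes_to (lie_series F x (\<lambda>x. deriv g (u x) * lie F u x)) (2 * l + 1)"
  shows "vanishes_to (lie_series F x (lie F u)) l"
proof -
  let ?a = "lie_series F x (\<lambda>x. deriv g (u x))" and ?b = "lie_series F x (lie F u)"
  let ?c = "lie_series F x (\<lambda>x. deriv (deriv g) (u x))"
  have g': "smooth_real_on UNIV (deriv g)" "smooth_real_on UNIV (deriv (deriv g))"
    using g smooth_real_on_deriv by blast+
  have su: "smooth_fun (lie F u)" by (rule smooth_fun_lie[OF F u])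
  have sa: "smooth_fun (\<lambda>x. deriv g (u x))" "smooth_fun (\<lambda>x. deriv (deriv g) (u x))"
    using smooth_fun.compose[OF g'(1) u] smooth_fun.compose[OF g'(2) u] by auto
  have ab: "vanishes_to (?a * ?b) (2 * l + 1)"
    using van lie_series_mult[OF F sa(1) su] by simp
  \<comment> \<open>If \<open>deriv g (u x)\<close> is nonzero, \<open>?a\<close> is a unit and no
    order is lost. At a zero, \<open>?c\<close> is a unit by \<open>nondeg\<close>, and
    \<open>vanishes_to_fold\<close> applies.\<close>
  show ?thesis
  proof (cases "deriv g (u x) = 0")
    case False
    then have "vanishes_to ?b (2 * l + 1)"
      using vanishes_to_unit_mult[OF ab] by (simp add: lie_series_nth)
    then show ?thesis by (rule vanishes_to_mono) simp
  next
    case True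
    have "lie F (\<lambda>x. deriv g (u x)) = (\<lambda>x. deriv (deriv g) (u x) * lie F u x)"
      using lie_compose[OF g'(1) u] by blast
    then have deriv: "fps_deriv ?a = ?c * ?b"
      using lie_series_mult[OF F sa(2) su] by (simp flip: lie_series_lie)
    show ?thesis
      by (rule vanishes_to_fold[OF _ deriv _ ab]) (use True nondeg in \<open>simp_all add: lie_series_nth\<close>)
  qed
qed

section \<open>Strict Lyapunov functions for dissipative systems\<close>

lemma smooth_real_on_mult:
  assumes "open S" "smooth_real_on S f" "smooth_real_on S g"
  shows "smooth_real_on S (\<lambda>x. f x * g x)"
  by (rule smooth_closure_imp_smooth[OF assms(1) smooth_closure.mult])
    (use assms smooth_closure.base in auto)

lemma smooth_real_on_power:
  assumes "open S" "smooth_real_on S f"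
  shows "smooth_real_on S (\<lambda>x. f x ^ n)"
proof (induction n)
  case (Suc n)
  show ?case using smooth_real_on_mult[OF assms Suc.IH] by simp
qed (simp add: smooth_real_on_const)

lemma smooth_real_on_wsharp_B:
  assumes "smooth_real_on {Q<..} \<phi>" "smooth_real_on {Q<..} \<Phi>" "\<And>h. Q < h \<Longrightarrow> \<phi> h > 0"
  shows "smooth_real_on {Q<..} (wsharp_B r \<phi> \<Phi> k)"
proof -
  have "smooth_real_on {Q<..} (\<lambda>h. inverse (\<phi> h))"
    using assms smooth_real_on_inverse by (metis greaterThan_iff less_irrefl open_greaterThan)
  then show ?thesis
    unfolding wsharp_B_def divide_inverse
    by (rule smooth_real_on_mult[OF open_greaterThan smooth_real_on_const
        smooth_real_on_power[OF open_greaterThan smooth_real_on_mult[OF open_greaterThan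
        smooth_real_on_power[OF open_greaterThan assms(2)]]]])
qed

text \<open>The weights satisfy \<open>B\<^sub>k\<^sup>2 = B\<^bsub>k-1\<^esub> B\<^bsub>k+1\<^esub> / 4\<close>, so that by AM-GM the mixed term
  \<open>B\<^sub>k l\<^bsub>k-1\<^esub> l\<^bsub>k+1\<^esub>\<close> is absorbed by the neighbouring squares.\<close>

lemma mixed_term_le:
  fixes t x y :: real
  assumes "t > 0"
  shows "2 ^ (Suc n * (Suc n + 1)) * t ^ Suc n * \<bar>x * y\<bar>
    \<le> (2 ^ (Suc (Suc n) * (Suc (Suc n) + 1)) * t ^ Suc (Suc n) * x\<^sup>2 + 2 ^ (n * (n + 1)) * t ^ n * y\<^sup>2) / 4"
proof -
  define c where "c = 2 ^ (n * (n + 1)) * t ^ n"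
  have c: "c > 0" using assms by (simp add: c_def)
  define e :: real where "e = 2 ^ (2 * (n + 1))"
  have 1: "2 ^ (Suc n * (Suc n + 1)) * t ^ Suc n = c * (e * t)"
    by (simp add: c_def e_def power_add power_mult power2_eq_square mult_ac)
  \<comment> \<open>The exponent \<open>n * (n + 1)\<close> has constant second difference 2; this
    is the origin of the factor 4 in \<open>4 * (e * t)\<^sup>2\<close>.\<close>
  have "(2::real) ^ (Suc (Suc n) * (Suc (Suc n) + 1)) = 2 ^ (n * (n + 1) + 2 * (2 * (n + 1)) + 2)"
    by (rule arg_cong[where f = "(^) 2"]) (simp add: algebra_simps)
  then have 2: "2 ^ (Suc (Suc n) * (Suc (Suc n) + 1)) * t ^ Suc (Suc n) = c * (4 * (e * t)\<^sup>2)"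
    by (simp add: c_def e_def power_add power_mult power2_eq_square mult_ac)
  have "4 * ((e * t) * \<bar>x * y\<bar>) \<le> (2 * (e * t) * \<bar>x\<bar>)\<^sup>2 + \<bar>y\<bar>\<^sup>2"
    using sum_squares_bound[of "2 * (e * t) * \<bar>x\<bar>" "\<bar>y\<bar>"] by (simp add: abs_mult mult_ac)
  then have "c * (4 * ((e * t) * \<bar>x * y\<bar>)) \<le> c * ((2 * (e * t) * \<bar>x\<bar>)\<^sup>2 + \<bar>y\<bar>\<^sup>2)"
    using c by (intro mult_left_mono) auto
  then show ?thesis unfolding 1 2 c_def[symmetric] by (simp add: power_mult_distrib algebra_simps)
qed

text \<open>Here \<open>l k\<close>, \<open>b k\<close>, \<open>db k\<close> and \<open>a\<close>
  stand for L_F^k H, B_k, B_k' and A' at one point. Each square \<open>s k\<close> is charged a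
  quarter by at most two neighbouring mixed terms, so half of it survives. The terms with a factor
  \<open>l 1\<close> are paid by \<open>a * l 1\<close>, with a surplus of
  \<open>- \<bar>l 1\<bar>\<close>. The last mixed term costs an extra \<open>\<phi> / 4\<close>,
  less than what \<open>lb\<close> provides.\<close>

lemma wsharp_derivative_negative:
  fixes l b db :: "nat \<Rightarrow> real" and \<phi> \<Phi> a :: real
  assumes r: "r \<ge> 3" and pos: "\<phi> > 0" "\<Phi> > 0" "\<phi> \<le> \<Phi>\<^sup>2"
    and ub: "\<And>k. k \<in> {1..r + 1} \<Longrightarrow> \<bar>l k\<bar> \<le> \<Phi>"
    and lb: "\<phi> \<le> \<bar>l 1\<bar> + (\<Sum>k = 2..r. \<bar>l k\<bar>\<^sup>2)"
    and neg: "l 1 \<le> 0"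
    and b: "\<And>k. b k = 2 ^ ((r - k) * (r - k + 1)) * (\<Phi>\<^sup>2 / \<phi>) ^ (r - k)"
    and a: "a > \<Phi>\<^sup>2 * (\<Sum>k = 2..r. \<bar>db k\<bar>) + \<Phi> * b 2 + 1"
  shows "a * l 1 - (\<Sum>k = 2..r. db k * l 1 * l (k - 1) * l k + b k * (l k * l k + l (k - 1) * l (k + 1))) < 0"
proof -
  define \<theta> where "\<theta> = \<Phi>\<^sup>2 / \<phi>"
  have \<theta>: "\<theta> \<ge> 1" using pos by (simp add: \<theta>_def field_simps)
  have b1: "b k \<ge> 1" for k
    unfolding b \<theta>_def[symmetric]
    using mult_mono[OF one_le_power[of "2 :: real"] one_le_power[OF \<theta>]] by simp
  define x where "x = \<bar>l 1\<bar>"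
  have x: "l 1 = - x" "x \<ge> 0" using neg by (auto simp: x_def)
  define s where "s k = b k * (l k)\<^sup>2" for k
  define m where "m k = b k * \<bar>l (k - 1) * l (k + 1)\<bar>" for k
  \<comment> \<open>There is no square for \<open>l (r + 1)\<close> in the sum; the constant
    \<open>\<phi>\<close> takes its place, so that \<open>m3\<close> has the same form at
    \<open>k = r\<close>.\<close>
  define e where "e k = (if k \<le> r then s k else \<phi>)" for k
  have s0: "s k \<ge> 0" for k using b1[of k] by (simp add: s_def)
  \<comment> \<open>\<open>m 2\<close> involves \<open>l 1\<close>, which has no square either; it
    is charged to the term \<open>\<Phi> * b 2\<close> in the lower bound on
    \<open>a\<close>.\<close>
  have m2: "m 2 \<le> x * (\<Phi> * b 2)"
  proof -
    have "b 2 * (x * \<bar>l 3\<bar>) \<le> b 2 * (x * \<Phi>)"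
      using b1[of 2] x ub[of 3] r by (intro mult_left_mono) auto
    then show ?thesis by (simp add: m_def x_def abs_mult mult_ac numeral_3_eq_3 numeral_2_eq_2)
  qed
  have m3: "m k \<le> (s (k - 1) + e (k + 1)) / 4" if k: "k \<in> {3..r}" for k
  proof (cases "k = r")
    case True
    \<comment> \<open>With this weight, the square inequality for
      \<open>2 * \<Phi> * \<bar>l (r - 1)\<bar>\<close> and \<open>\<phi>\<close>, divided by
      \<open>\<phi>\<close>, has exactly \<open>s (r - 1) + \<phi>\<close> on the right.\<close>
    have "b (r - 1) = 4 * \<theta>" using r by (simp add: b \<theta>_def)
    then have s: "s (k - 1) = 4 * \<Phi>\<^sup>2 / \<phi> * (l (r - 1))\<^sup>2" using True by (simp add: s_def \<theta>_def)
    have "m k = \<bar>l (r - 1)\<bar> * \<bar>l (r + 1)\<bar>" using True by (simp add: m_def b abs_mult)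
    also have "\<dots> \<le> \<bar>l (r - 1)\<bar> * \<Phi>" using ub[of "r + 1"] by (intro mult_left_mono) auto
    finally have mk: "m k \<le> \<bar>l (r - 1)\<bar> * \<Phi>" .
    have "4 * (\<bar>l (r - 1)\<bar> * \<Phi>) * \<phi> \<le> (2 * \<Phi> * \<bar>l (r - 1)\<bar>)\<^sup>2 + \<phi>\<^sup>2"
      using sum_squares_bound[of "2 * \<Phi> * \<bar>l (r - 1)\<bar>" \<phi>] by (simp add: mult_ac)
    then have "4 * (\<bar>l (r - 1)\<bar> * \<Phi>) \<le> s (k - 1) + \<phi>"
      unfolding s using pos by (simp add: field_simps power2_eq_square)
    then show ?thesis using mk True by (simp add: e_def)
  next
    case False
    define n where "n = r - k - 1"
    have n: "r - k = Suc n" "r - (k - 1) = Suc (Suc n)" "r - (k + 1) = n" "k + 1 \<le> r"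
      using False k by (auto simp: n_def)
    show ?thesis
      using mixed_term_le[of \<theta> n "l (k - 1)" "l (k + 1)"] \<theta> n(4)
      unfolding m_def s_def e_def b n \<theta>_def[symmetric] by simp
  qed
  have ms: "(\<Sum>k = 2..r. m k) \<le> x * (\<Phi> * b 2) + ((\<Sum>k = 2..r. s k) / 2 + \<phi> / 4)"
  proof -
    have "(\<Sum>k = 2..r. m k) = m 2 + (\<Sum>k = 3..r. m k)"
      using r by (subst sum.atLeast_Suc_atMost) (auto simp: numeral_3_eq_3 numeral_2_eq_2)
    moreover have "(\<Sum>k = 3..r. m k) \<le> ((\<Sum>k = 3..r. s (k - 1)) + (\<Sum>k = 3..r. e (k + 1))) / 4"
      unfolding sum.distrib[symmetric] sum_divide_distrib by (rule sum_mono) (rule m3)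
    moreover have "(\<Sum>k = 3..r. s (k - 1)) \<le> (\<Sum>k = 2..r. s k)"
    proof -
      have "(\<Sum>k = 3..r. s (k - 1)) = (\<Sum>k = 2..r - 1. s k)"
        by (rule sum.reindex_bij_witness[of _ "\<lambda>k. k + 1" "\<lambda>k. k - 1"]) (use r in auto)
      also have "\<dots> \<le> (\<Sum>k = 2..r. s k)" by (rule sum_mono2) (use s0 in auto)
      finally show ?thesis .
    qed
    moreover have "(\<Sum>k = 3..r. e (k + 1)) \<le> (\<Sum>k = 2..r. s k) + \<phi>"
    proof -
      have "(\<Sum>k = 3..r. e (k + 1)) = (\<Sum>k = 4..Suc r. e k)"
        by (rule sum.reindex_bij_witness[of _ "\<lambda>k. k - 1" "\<lambda>k. k + 1"]) auto
      also have "\<dots> = (\<Sum>k = 4..r. e k) + \<phi>" using r by (simp add: e_def)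
      also have "(\<Sum>k = 4..r. e k) = (\<Sum>k = 4..r. s k)" by (rule sum.cong) (auto simp: e_def)
      also have "\<dots> \<le> (\<Sum>k = 2..r. s k)" by (rule sum_mono2) (use s0 in auto)
      finally show ?thesis by simp
    qed
    moreover have "M \<le> c + (S / 2 + f / 4)"
      if "M = a + T" "T \<le> (P + E) / 4" "P \<le> S" "E \<le> S + f" "a \<le> c"
      for M a T P E S f c :: real
      using that by simp
    ultimately show ?thesis using m2 by metis
  qed
  have ss: "(\<Sum>k = 2..r. \<bar>l k\<bar>\<^sup>2) \<le> (\<Sum>k = 2..r. s k)"
  proof (rule sum_mono)
    show "\<bar>l k\<bar>\<^sup>2 \<le> s k" for k
      using mult_right_mono[OF b1, of "(l k)\<^sup>2" k] by (simp add: s_def)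
  qed
  have summand: "- (db k * l 1 * l (k - 1) * l k + b k * (l k * l k + l (k - 1) * l (k + 1)))
      \<le> x * (\<Phi>\<^sup>2 * \<bar>db k\<bar>) - s k + m k" if k: "k \<in> {2..r}" for k
  proof -
    have "\<bar>l (k - 1)\<bar> \<le> \<Phi>" "\<bar>l k\<bar> \<le> \<Phi>" by (rule ub; use k in auto)+
    then have "\<bar>l (k - 1)\<bar> * \<bar>l k\<bar> \<le> \<Phi> * \<Phi>" by (intro mult_mono) auto
    then have "x * (\<bar>db k\<bar> * (\<bar>l (k - 1)\<bar> * \<bar>l k\<bar>)) \<le> x * (\<bar>db k\<bar> * (\<Phi> * \<Phi>))"
      using x by (intro mult_left_mono) auto
    moreover have "- (db k * l 1 * l (k - 1) * l k) \<le> \<bar>db k * l 1 * l (k - 1) * l k\<bar>" by simp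
    ultimately have 1: "- (db k * l 1 * l (k - 1) * l k) \<le> x * (\<Phi>\<^sup>2 * \<bar>db k\<bar>)"
      by (simp add: abs_mult x_def power2_eq_square mult_ac)
    have "b k * (- (l (k - 1) * l (k + 1))) \<le> m k"
      unfolding m_def using b1[of k] by (intro mult_left_mono) auto
    then show ?thesis using 1 by (simp add: s_def power2_eq_square algebra_simps)
  qed
  have "- (\<Sum>k = 2..r. db k * l 1 * l (k - 1) * l k + b k * (l k * l k + l (k - 1) * l (k + 1)))
      \<le> (\<Sum>k = 2..r. x * (\<Phi>\<^sup>2 * \<bar>db k\<bar>) - s k + m k)"
    unfolding sum_negf[symmetric] by (rule sum_mono) (rule summand)
  also have "\<dots> = x * (\<Phi>\<^sup>2 * (\<Sum>k = 2..r. \<bar>db k\<bar>)) - (\<Sum>k = 2..r. s k) + (\<Sum>k = 2..r. m k)"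
    by (simp add: sum.distrib sum_subtractf sum_distrib_left)
  finally have 1: "- (\<Sum>k = 2..r. db k * l 1 * l (k - 1) * l k + b k * (l k * l k + l (k - 1) * l (k + 1)))
      \<le> x * (\<Phi>\<^sup>2 * (\<Sum>k = 2..r. \<bar>db k\<bar>) + \<Phi> * b 2) - (\<Sum>k = 2..r. s k) / 2 + \<phi> / 4"
    using ms by (simp add: algebra_simps)
  have "a * l 1 \<le> - x * (\<Phi>\<^sup>2 * (\<Sum>k = 2..r. \<bar>db k\<bar>) + \<Phi> * b 2 + 1)"
    unfolding x(1) using mult_left_mono[OF less_imp_le[OF a] x(2)] by (simp add: mult.commute)
  then have "a * l 1 - (\<Sum>k = 2..r. db k * l 1 * l (k - 1) * l k + b k * (l k * l k + l (k - 1) * l (k + 1)))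
      \<le> - x - (\<Sum>k = 2..r. s k) / 2 + \<phi> / 4"
    using 1 by (simp add: algebra_simps)
  \<comment> \<open>By \<open>lb\<close> and \<open>ss\<close>, \<open>\<phi>\<close> is at most
    \<open>x\<close> plus the sum of the \<open>s k\<close>, so the value is at most
    \<open>- \<phi> / 4\<close>.\<close>
  also have "\<dots> < 0" using lb ss x pos unfolding x_def[symmetric] by linarith
  finally show ?thesis .
qed

text \<open>The strip between two levels is compact. Continuity of \<open>M\<close> is asked only
  above level \<open>a\<close>, because \<open>M\<close> will contain the inverse of a quantity
  known to be positive only above \<open>Q\<close>.\<close>

lemma proper_fun_bounded_strip:
  fixes M :: "'a::euclidean_space \<Rightarrow> real"
  assumes "proper_fun H" "continuous_on UNIV H" "continuous_on {x. a \<le> H x} M"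
  shows "\<exists>B. \<forall>x. H x \<in> {a..b} \<longrightarrow> M x \<le> B"
proof -
  have "closed {x. a \<le> H x}" using assms(2) by (intro closed_Collect_le continuous_on_const)
  then have "compact ({x. H x \<le> b} \<inter> {x. a \<le> H x})"
    using assms(1) by (auto simp: proper_fun_def intro: compact_Int_closed)
  moreover have "continuous_on ({x. H x \<le> b} \<inter> {x. a \<le> H x}) M"
    by (rule continuous_on_subset[OF assms(3)]) auto
  ultimately have "bounded (M ` ({x. H x \<le> b} \<inter> {x. a \<le> H x}))"
    using compact_continuous_image compact_imp_bounded by blast
  then obtain B where "\<forall>y\<in>M ` ({x. H x \<le> b} \<inter> {x. a \<le> H x}). norm y \<le> B"
    unfolding bounded_iff by blast
  then show ?thesis by (intro exI[of _ B]) force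
qed

text \<open>Separates the construction of \<open>W\<close> from the chain, which enters only through
  these properties.\<close>

locale dissipative =
  fixes F :: "'a::euclidean_space \<Rightarrow> 'a" and H :: "'a \<Rightarrow> real" and r :: nat and Q :: real
  assumes F: "smooth_field F" and H: "smooth_fun H" and proper: "proper_fun H"
    and dissip: "\<And>x. lie F H x \<le> 0"
    and r: "r \<ge> 3"
    and nondeg: "\<And>x. H x > Q \<Longrightarrow> \<exists>k\<in>{1..r}. (lie F ^^ k) H x \<noteq> 0"
begin

abbreviation L :: "nat \<Rightarrow> 'a \<Rightarrow> real" where "L k \<equiv> (lie F ^^ k) H"

lemma smooth_L: "smooth_fun (L k)"
  by (rule smooth_fun_lie_funpow[OF F H])

text \<open>One majorant serves both purposes, \<open>\<Phi> = \<Psi>\<close> and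
  \<open>\<phi> = 1 / \<Psi>\<close>: on each level \<open>\<Psi>\<close> dominates the Lie
  derivatives and the inverse of the positive quantity \<open>D\<close> that \<open>\<phi>\<close>
  must bound from below. From \<open>\<Psi> \<ge> 1\<close> follows
  \<open>\<phi> \<le> \<Phi>\<^sup>2\<close>.\<close>

lemma wsharp_bounds_exist: "\<exists>\<phi> \<Phi>. wsharp_bounds F H r Q \<phi> \<Phi>"
proof -
  define D where "D x = \<bar>lie F H x\<bar> + (\<Sum>k = 2..r. \<bar>L k x\<bar>\<^sup>2)" for x
  have D: "D x > 0" if x: "H x > Q" for x
  proof -
    obtain k where k: "k \<in> {1..r}" "L k x \<noteq> 0" using nondeg[OF x] by blast
    have nn: "(\<Sum>k = 2..r. \<bar>L k x\<bar>\<^sup>2) \<ge> 0" by (simp add: sum_nonneg)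
    show ?thesis
    proof (cases "k = 1")
      case True
      then show ?thesis using k nn by (simp add: D_def add_pos_nonneg)
    next
      case False
      then have "(\<Sum>k = 2..r. \<bar>L k x\<bar>\<^sup>2) > 0"
        using k by (intro sum_pos2[of _ k]) auto
      then show ?thesis by (simp add: D_def add_nonneg_pos)
    qed
  qed
  define M where "M x = 1 + inverse (D x) + (\<Sum>k = 1..r + 1. \<bar>L k x\<bar>)" for x
  have contL: "continuous_on X (L k)" "continuous_on X (lie F H)" for X k
    using smooth_L smooth_L[of 1] smooth_fun_continuous_on by auto
  have "continuous_on {x. a \<le> H x} M" if "a > Q" for a
    unfolding M_def D_def using that D
    by (intro continuous_intros contL ballI) (metis D_def less_irrefl mem_Collect_eq order_less_le_trans)
  then have bdd: "\<exists>B. \<forall>x. H x \<in> {a..b} \<longrightarrow> M x \<le> B" if "a > Q" for a b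
    using that proper_fun_bounded_strip[OF proper smooth_fun_continuous_on[OF H]] by blast
  \<comment> \<open>The inserted 1 yields \<open>\<Psi> h \<ge> 1\<close> also on levels
    \<open>h\<close> that \<open>H\<close> may not attain.\<close>
  have "\<exists>B. \<forall>h\<in>{a..b}. \<forall>y\<in>insert 1 (M ` {x. H x = h}). y \<le> B" if ab: "a > Q" for a b
  proof -
    obtain B where "\<forall>x. H x \<in> {a..b} \<longrightarrow> M x \<le> B" using bdd[OF ab] by blast
    then show ?thesis by (intro exI[of _ "max 1 B"]) (auto simp: le_max_iff_disj)
  qed
  then obtain \<Psi> where \<Psi>: "smooth_real_on {Q<..} \<Psi>"
    "\<And>h y. Q < h \<Longrightarrow> y \<in> insert 1 (M ` {x. H x = h}) \<Longrightarrow> y \<le> \<Psi> h"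
    using smooth_majorant[of Q "\<lambda>h. insert 1 (M ` {x. H x = h})"] by metis
  have \<Psi>1: "\<Psi> h \<ge> 1" if "h > Q" for h using \<Psi>(2)[OF that] by blast
  have \<Psi>M: "M x \<le> \<Psi> (H x)" if "H x > Q" for x using \<Psi>(2)[OF that] by blast
  have "wsharp_bounds F H r Q (\<lambda>h. inverse (\<Psi> h)) \<Psi>"
    unfolding wsharp_bounds_def
  proof (intro conjI allI impI ballI)
    show "smooth_real_on {Q<..} (\<lambda>h. inverse (\<Psi> h))"
      by (rule smooth_real_on_inverse[OF open_greaterThan \<Psi>(1)]) (use \<Psi>1 in force)
    fix h assume h: "h > Q"
    show "inverse (\<Psi> h) > 0" "\<Psi> h > 0" using \<Psi>1[OF h] by auto
    have "inverse (\<Psi> h) \<le> 1" "1 \<le> (\<Psi> h)\<^sup>2"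
      using \<Psi>1[OF h] by (auto simp: field_simps)
    then show "inverse (\<Psi> h) \<le> (\<Psi> h)\<^sup>2" by linarith
  next
    fix x assume x: "H x > Q"
    have nn: "(\<Sum>k = 1..r + 1. \<bar>L k x\<bar>) \<ge> 0" "inverse (D x) > 0" using D[OF x] by (auto simp: sum_nonneg)
    then have "inverse (D x) \<le> \<Psi> (H x)" using \<Psi>M[OF x] unfolding M_def by linarith
    then show "inverse (\<Psi> (H x)) \<le> \<bar>lie F H x\<bar> + (\<Sum>k = 2..r. \<bar>L k x\<bar>\<^sup>2)"
      using le_imp_inverse_le[of "inverse (D x)" "\<Psi> (H x)"] nn by (simp add: D_def)
    fix k assume "k \<in> {1..r + 1}"
    then have "\<bar>L k x\<bar> \<le> (\<Sum>k = 1..r + 1. \<bar>L k x\<bar>)" by (intro member_le_sum) auto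
    then show "\<bar>L k x\<bar> \<le> \<Psi> (H x)" using \<Psi>M[OF x] nn unfolding M_def by linarith
  qed (rule \<Psi>(1))
  then show ?thesis by blast
qed

context
  fixes \<phi> \<Phi> :: "real \<Rightarrow> real"
  assumes bounds: "wsharp_bounds F H r Q \<phi> \<Phi>"
begin

abbreviation B :: "nat \<Rightarrow> real \<Rightarrow> real" where "B k \<equiv> wsharp_B r \<phi> \<Phi> k"

lemma smooth_B: "smooth_real_on {Q<..} (B k)"
  by (rule smooth_real_on_wsharp_B) (use bounds in \<open>auto simp: wsharp_bounds_def\<close>)

lemma DERIV_B: "h > Q \<Longrightarrow> (B k has_real_derivative deriv (B k) h) (at h)"
  using smooth_real_on_imp_DERIV[OF smooth_B] by simp

lemma B_nonneg: "h > Q \<Longrightarrow> B k h \<ge> 0"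
  using bounds by (auto simp: wsharp_bounds_def wsharp_B_def intro!: mult_nonneg_nonneg zero_le_power
      divide_nonneg_pos)

text \<open>A smooth majorant of \<open>T h + \<bar>S' h\<bar> + 1\<close> is taken for the
  derivative of \<open>A\<close>: \<open>T\<close> is the prescribed lower bound, and
  \<open>S (H x)\<close> bounds the sum subtracted in \<open>W\<close>. Then \<open>A - S\<close>
  has slope at least 1, so above level \<open>Q + \<epsilon>\<close> every \<open>W\<close>
  dominates \<open>H\<close> up to a constant, and its sublevel sets lie in sublevel sets of
  \<open>H\<close>.\<close>

lemma wsharp_A_exists: "\<exists>A. wsharp_A F H r Q \<phi> \<Phi> A"
proof -
  have \<Phi>: "smooth_real_on {Q<..} \<Phi>" using bounds by (simp add: wsharp_bounds_def)
  define T where "T h = (\<Phi> h)\<^sup>2 * (\<Sum>k = 2..r. \<bar>deriv (B k) h\<bar>) + \<Phi> h * B 2 h + 1" for h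
  define S where "S h = (\<Sum>k = 2..r. B k h * (\<Phi> h)\<^sup>2)" for h
  define S' where "S' h = (\<Sum>k = 2..r. deriv (B k) h * (\<Phi> h)\<^sup>2 + B k h * (2 * \<Phi> h * deriv \<Phi> h))" for h
  have S: "(S has_real_derivative S' h) (at h)" if "h > Q" for h
    unfolding S_def S'_def using that
    by (auto intro!: derivative_eq_intros DERIV_B smooth_real_on_imp_DERIV[OF \<Phi>] simp: algebra_simps)
  note cont = smooth_real_on_continuous_on[OF smooth_B]
    smooth_real_on_continuous_on[OF smooth_real_on_deriv[OF smooth_B]]
    smooth_real_on_continuous_on[OF \<Phi>]
    smooth_real_on_continuous_on[OF smooth_real_on_deriv[OF \<Phi>]]
  have contT: "continuous_on {Q<..} (\<lambda>h. T h + \<bar>S' h\<bar> + 1)"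
    unfolding T_def S'_def by (intro continuous_intros cont)
  have "\<exists>C. \<forall>h\<in>{a..b}. \<forall>y\<in>{T h + \<bar>S' h\<bar> + 1}. y \<le> C" if "a > Q" for a b
  proof -
    have "continuous_on {a..b} (\<lambda>h. T h + \<bar>S' h\<bar> + 1)"
      by (rule continuous_on_subset[OF contT]) (use that in auto)
    then have "bounded ((\<lambda>h. T h + \<bar>S' h\<bar> + 1) ` {a..b})"
      by (intro compact_imp_bounded compact_continuous_image) auto
    then obtain C where "\<forall>y\<in>(\<lambda>h. T h + \<bar>S' h\<bar> + 1) ` {a..b}. norm y \<le> C"
      unfolding bounded_iff by blast
    then show ?thesis by (intro exI[of _ C]) force
  qed
  then obtain A' where A': "smooth_real_on {Q<..} A'"
    "\<And>h. Q < h \<Longrightarrow> T h + \<bar>S' h\<bar> + 1 \<le> A' h"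
    using smooth_majorant[of Q "\<lambda>h. {T h + \<bar>S' h\<bar> + 1}"] by (metis singletonI)
  obtain A where A: "\<And>h. Q < h \<Longrightarrow> (A has_real_derivative A' h) (at h)"
    using antiderivative_on_greaterThan[OF smooth_real_on_continuous_on[OF A'(1)]] by blast
  have T0: "T h \<ge> 0" if "h > Q" for h
    using that B_nonneg[OF that] bounds by (auto simp: T_def wsharp_bounds_def less_imp_le
        intro!: add_nonneg_nonneg mult_nonneg_nonneg sum_nonneg)
  have growth: "A c - S c + (h - c) \<le> A h - S h" if "Q < c" "c \<le> h" for c h
  proof -
    have "A c - S c - c \<le> A h - S h - h"
    proof (rule DERIV_nonneg_imp_nondecreasing[OF that(2)])
      fix y assume "c \<le> y" "y \<le> h"
      then have y: "Q < y" using that by simp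
      have "((\<lambda>h. A h - S h - h) has_real_derivative (A' y - S' y - 1)) (at y)"
        using A[OF y] S[OF y] by (auto intro!: derivative_eq_intros)
      moreover have "A' y - S' y - 1 \<ge> 0" using A'(2)[OF y] T0[OF y] by linarith
      ultimately show "\<exists>d. ((\<lambda>h. A h - S h - h) has_real_derivative d) (at y) \<and> d \<ge> 0" by blast
    qed
    then show ?thesis by simp
  qed
  have "wsharp_A F H r Q \<phi> \<Phi> A"
    unfolding wsharp_A_def
  proof (intro conjI allI impI)
    show "smooth_real_on {Q<..} A"
      by (rule smooth_real_on_antiderivative[OF _ A'(1)]) (use A in auto)
    fix h assume h: "Q < h"
    show "(\<Phi> h)\<^sup>2 * (\<Sum>k = 2..r. \<bar>deriv (B k) h\<bar>) + \<Phi> h * B 2 h + 1 < deriv A h"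
      using A'(2)[OF h] by (simp add: DERIV_imp_deriv[OF A[OF h]] T_def)
  next
    fix \<epsilon> :: real and W assume \<epsilon>: "\<epsilon> > 0" and W: "is_wsharp F H r Q \<phi> \<Phi> A \<epsilon> W"
    have WC: "C1_smooth W" and Wx: "\<And>x. H x > Q + \<epsilon> \<Longrightarrow> W x = wsharp_formula F H r \<phi> \<Phi> A x"
      using W by (auto simp: is_wsharp_def)
    have lower: "A (H x) - S (H x) \<le> W x" if x: "H x > Q + \<epsilon>" for x
    proof -
      have h: "H x > Q" using x \<epsilon> by simp
      have "B k (H x) * L (k - 1) x * L k x \<le> B k (H x) * (\<Phi> (H x))\<^sup>2" if "k \<in> {2..r}" for k
      proof -
        have *: "\<bar>L j x\<bar> \<le> \<Phi> (H x)" if "j \<in> {1..r + 1}" for j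
          using bounds h that unfolding wsharp_bounds_def by blast
        have "\<bar>L (k - 1) x\<bar> \<le> \<Phi> (H x)" "\<bar>L k x\<bar> \<le> \<Phi> (H x)"
          by (rule *; use that in auto)+
        then have "\<bar>L (k - 1) x\<bar> * \<bar>L k x\<bar> \<le> \<Phi> (H x) * \<Phi> (H x)"
          by (intro mult_mono) auto
        then have "L (k - 1) x * L k x \<le> (\<Phi> (H x))\<^sup>2"
          using abs_ge_self[of "L (k - 1) x * L k x"] by (simp add: abs_mult power2_eq_square)
        then show ?thesis using mult_left_mono[OF _ B_nonneg[OF h]] by (simp add: mult.assoc)
      qed
      then show ?thesis unfolding Wx[OF x] wsharp_formula_def S_def
        by (intro diff_left_mono sum_mono)
    qed
    show "proper_fun W"
      unfolding proper_fun_def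
    proof
      fix c
      define c0 where "c0 = Q + \<epsilon>"
      define b where "b = c0 + \<bar>c - A c0 + S c0\<bar>"
      have "H x \<le> b" if "W x \<le> c" for x
      proof (cases "H x > c0")
        case True
        then have "A c0 - S c0 + (H x - c0) \<le> W x"
          using growth[of c0 "H x"] lower[of x] \<epsilon> by (auto simp: c0_def)
        then show ?thesis using that by (simp add: b_def)
      qed (simp add: b_def)
      then have "{x. W x \<le> c} = {x. H x \<le> b} \<inter> {x. W x \<le> c}" by auto
      moreover have "closed {x. W x \<le> c}"
        by (intro closed_Collect_le continuous_on_const C1_smooth_continuous_on WC)
      ultimately show "compact {x. W x \<le> c}"
        using proper compact_Int_closed unfolding proper_fun_def by metis
    qed
  qed
  then show ?thesis by blast
qed

text \<open>The weights are general because the formula is used twice: with C1 extensions of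
  \<open>A\<close> and \<open>B k\<close> to the whole line, and with \<open>A\<close> and
  \<open>B k\<close> themselves.\<close>

lemma GDERIV_weighted_formula:
  assumes "(a has_real_derivative a') (at (H x))"
    and "\<And>k. k \<in> {2..r} \<Longrightarrow> (b k has_real_derivative b' k) (at (H x))"
  shows "GDERIV (\<lambda>x. a (H x) - (\<Sum>k = 2..r. b k (H x) * L (k - 1) x * L k x)) x :>
    a' *\<^sub>R grad H x - (\<Sum>k = 2..r. (b k (H x) * L (k - 1) x) *\<^sub>R grad (L k) x
      + L k x *\<^sub>R (b k (H x) *\<^sub>R grad (L (k - 1)) x + L (k - 1) x *\<^sub>R (b' k *\<^sub>R grad H x)))"
  by (intro GDERIV_diff GDERIV_sum GDERIV_mult GDERIV_DERIV_compose smooth_fun_GDERIV H smooth_L assms)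

context
  fixes A :: "real \<Rightarrow> real" and \<epsilon> :: real
  assumes A: "wsharp_A F H r Q \<phi> \<Phi> A" and \<epsilon>: "\<epsilon> > 0"
begin

lemma DERIV_A: "h > Q \<Longrightarrow> (A has_real_derivative deriv A h) (at h)"
  using A smooth_real_on_imp_DERIV[of "{Q<..}" A h] by (simp add: wsharp_A_def)

text \<open>Only the scalar weights may be singular at level \<open>Q\<close>. Extending them to the
  line and keeping the formula extends \<open>W\<close>, since \<open>H\<close> and the
  \<open>L k\<close> are smooth everywhere.\<close>

lemma is_wsharp_exists: "\<exists>W. is_wsharp F H r Q \<phi> \<Phi> A \<epsilon> W"
proof -
  have c: "Q < Q + \<epsilon>" using \<epsilon> by simp
  have smA: "smooth_real_on {Q<..} A" using A by (simp add: wsharp_A_def)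
  obtain a a' where a: "\<And>h. (a has_real_derivative a' h) (at h)" "continuous_on UNIV a'"
    "\<And>h. Q + \<epsilon> < h \<Longrightarrow> a h = A h"
    using C1_extension[OF c DERIV_A smooth_real_on_continuous_on[OF smooth_real_on_deriv[OF smA]]]
    by blast
  have "\<exists>b b'. (\<forall>h. (b has_real_derivative b' h) (at h)) \<and> continuous_on UNIV b' \<and>
      (\<forall>h>Q + \<epsilon>. b h = B k h)" for k
    using C1_extension[OF c DERIV_B smooth_real_on_continuous_on[OF smooth_real_on_deriv[OF smooth_B]]]
    by metis
  then obtain b b' where b: "\<And>k h. (b k has_real_derivative b' k h) (at h)"
    "\<And>k. continuous_on UNIV (b' k)" "\<And>k h. Q + \<epsilon> < h \<Longrightarrow> b k h = B k h"
    by metis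
  define W where "W x = a (H x) - (\<Sum>k = 2..r. b k (H x) * L (k - 1) x * L k x)" for x
  have contH: "continuous_on UNIV (\<lambda>x. f (H x))" if "continuous_on UNIV f" for f :: "real \<Rightarrow> real"
    by (rule continuous_on_compose2[OF that smooth_fun_continuous_on[OF H]]) auto
  have contb: "continuous_on UNIV (b k)" for k
    using b(1) DERIV_isCont continuous_at_imp_continuous_on by blast
  have "C1_smooth W"
    unfolding C1_smooth_def
  proof (intro exI conjI allI)
    show "GDERIV W x :> a' (H x) *\<^sub>R grad H x - (\<Sum>k = 2..r. (b k (H x) * L (k - 1) x) *\<^sub>R grad (L k) x
      + L k x *\<^sub>R (b k (H x) *\<^sub>R grad (L (k - 1)) x + L (k - 1) x *\<^sub>R (b' k (H x) *\<^sub>R grad H x)))" for x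
      unfolding W_def by (rule GDERIV_weighted_formula) (use a b in auto)
    show "continuous_on UNIV (\<lambda>x. a' (H x) *\<^sub>R grad H x - (\<Sum>k = 2..r. (b k (H x) * L (k - 1) x) *\<^sub>R grad (L k) x
      + L k x *\<^sub>R (b k (H x) *\<^sub>R grad (L (k - 1)) x + L (k - 1) x *\<^sub>R (b' k (H x) *\<^sub>R grad H x))))"
      by (intro continuous_on_diff continuous_on_sum continuous_on_add continuous_on_scaleR
          continuous_on_mult contH[OF a(2)] contH[OF b(2)] contH[OF contb]
          smooth_fun_continuous_on[OF smooth_L] smooth_fun_continuous_on_grad[OF smooth_L]
          smooth_fun_continuous_on_grad[OF H])
  qed
  moreover have "W x = wsharp_formula F H r \<phi> \<Phi> A x" if "H x > Q + \<epsilon>" for x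
    using a(3)[OF that] b(3)[OF that] by (simp add: W_def wsharp_formula_def)
  ultimately show ?thesis unfolding is_wsharp_def by blast
qed

lemma lie_wsharp_negative:
  assumes W: "is_wsharp F H r Q \<phi> \<Phi> A \<epsilon> W" and x: "H x > Q + \<epsilon>"
  shows "lie F W x < 0"
proof -
  have h: "H x > Q" using x \<epsilon> by simp
  have op: "open {y. H y > Q + \<epsilon>}"
    by (intro open_Collect_less continuous_on_const smooth_fun_continuous_on[OF H])
  let ?g = "deriv A (H x) *\<^sub>R grad H x - (\<Sum>k = 2..r. (B k (H x) * L (k - 1) x) *\<^sub>R grad (L k) x
      + L k x *\<^sub>R (B k (H x) *\<^sub>R grad (L (k - 1)) x + L (k - 1) x *\<^sub>R (deriv (B k) (H x) *\<^sub>R grad H x)))"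
  have "GDERIV (\<lambda>x. A (H x) - (\<Sum>k = 2..r. B k (H x) * L (k - 1) x * L k x)) x :> ?g"
    by (rule GDERIV_weighted_formula) (use DERIV_A DERIV_B h in auto)
  then have "GDERIV W x :> ?g"
    unfolding gderiv_def
    by (rule has_derivative_transform_within_open[OF _ op])
      (use x W in \<open>auto simp: is_wsharp_def wsharp_formula_def\<close>)
  then have "lie F W x = ?g \<bullet> F x" by (rule lie_eq)
  also have "\<dots> = deriv A (H x) * L 1 x - (\<Sum>k = 2..r. deriv (B k) (H x) * L 1 x * L (k - 1) x * L k x
      + B k (H x) * (L k x * L k x + L (k - 1) x * L (k + 1) x))"
  proof -
    have 1: "grad (L k) x \<bullet> F x = L (k + 1) x" "grad H x \<bullet> F x = L 1 x" for k
      by (simp_all add: lie_def)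
    have 2: "grad (L (k - 1)) x \<bullet> F x = L k x" if "k \<in> {2..r}" for k
    proof -
      have "k - 1 + 1 = k" using that by simp
      then show ?thesis using 1(1)[of "k - 1"] by metis
    qed
    show ?thesis
      unfolding inner_diff_left inner_sum_left
      by (intro arg_cong2[where f = "(-)"] sum.cong)
        (simp_all only: inner_add_left inner_scaleR_left 1 2, simp_all add: algebra_simps)
  qed
  also have "\<dots> < 0"
  proof (rule wsharp_derivative_negative[OF r])
    show "\<phi> (H x) > 0" "\<Phi> (H x) > 0" "\<phi> (H x) \<le> (\<Phi> (H x))\<^sup>2"
      "\<And>k. k \<in> {1..r + 1} \<Longrightarrow> \<bar>L k x\<bar> \<le> \<Phi> (H x)"
      "\<phi> (H x) \<le> \<bar>L 1 x\<bar> + (\<Sum>k = 2..r. \<bar>L k x\<bar>\<^sup>2)"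
      using bounds h by (auto simp: wsharp_bounds_def)
    show "L 1 x \<le> 0" using dissip by simp
    show "(\<Phi> (H x))\<^sup>2 * (\<Sum>k = 2..r. \<bar>deriv (B k) (H x)\<bar>) + \<Phi> (H x) * B 2 (H x) + 1 < deriv A (H x)"
      using A h by (simp add: wsharp_A_def)
  qed (simp add: wsharp_B_def)
  finally show ?thesis .
qed

lemma is_wsharp_strict_lyapunov:
  assumes W: "is_wsharp F H r Q \<phi> \<Phi> A \<epsilon> W"
  shows "\<exists>Q'. strict_lyapunov_outside F W Q'"
proof -
  have WC: "C1_smooth W" using W by (simp add: is_wsharp_def)
  have "compact (W ` {x. H x \<le> Q + \<epsilon>})"
    by (intro compact_continuous_image C1_smooth_continuous_on WC) (use proper in \<open>simp add: proper_fun_def\<close>)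
  then have "bounded (W ` {x. H x \<le> Q + \<epsilon>})" by (rule compact_imp_bounded)
  \<comment> \<open>\<open>Q'\<close> bounds \<open>W\<close> on the compact set where
    \<open>W\<close> is an arbitrary extension; above \<open>Q'\<close> only the region of
    \<open>lie_wsharp_negative\<close> remains.\<close>
  then obtain Q' where "\<forall>y\<in>W ` {x. H x \<le> Q + \<epsilon>}. norm y \<le> Q'" unfolding bounded_iff by blast
  then have Q': "H x > Q + \<epsilon>" if "W x > Q'" for x
    using that by (metis (mono_tags, lifting) abs_ge_self image_eqI linorder_not_less mem_Collect_eq
        order.strict_trans1 real_norm_def)
  have "proper_fun W" using A W \<epsilon> unfolding wsharp_A_def by blast
  then have "strict_lyapunov_outside F W Q'"
    using WC Q' lie_wsharp_negative[OF W] by (auto simp: strict_lyapunov_outside_def)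
  then show ?thesis by blast
qed

end

end

end

section \<open>The chain of oscillators\<close>

lemma continuous_bounded_interval:
  fixes f :: "real \<Rightarrow> real"
  assumes "continuous_on UNIV f"
  obtains C where "C \<ge> 0" "\<And>x. \<bar>x\<bar> \<le> X \<Longrightarrow> \<bar>f x\<bar> \<le> C"
proof -
  have "bounded (f ` {- X..X})"
    using assms continuous_on_subset by (intro compact_imp_bounded compact_continuous_image) blast+
  then obtain C where C: "\<forall>y\<in>f ` {- X..X}. norm y \<le> C" unfolding bounded_iff by blast
  have "\<bar>f x\<bar> \<le> max 0 C" if "\<bar>x\<bar> \<le> X" for x
  proof -
    have "x \<in> {- X..X}" using that by auto
    then have "norm (f x) \<le> C" using C by blast
    then show ?thesis by simp
  qed
  then show thesis using that[of "max 0 C"] by simp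
qed

lemma lower_bound_from_tails:
  fixes f :: "real \<Rightarrow> real"
  assumes "continuous_on UNIV f" "\<And>x. X \<le> x \<Longrightarrow> M * \<bar>x\<bar> - C0 \<le> f x"
    "\<And>x. x \<le> - X \<Longrightarrow> M * \<bar>x\<bar> - C0 \<le> f x"
  shows "\<exists>C. \<forall>x. M * \<bar>x\<bar> - C \<le> f x"
proof -
  have "continuous_on UNIV (\<lambda>x. f x - M * \<bar>x\<bar>)" by (intro continuous_intros assms)
  then obtain C1 where C1: "\<And>x. \<bar>x\<bar> \<le> X \<Longrightarrow> \<bar>f x - M * \<bar>x\<bar>\<bar> \<le> C1"
    by (rule continuous_bounded_interval[where X = X]) blast
  have "M * \<bar>x\<bar> - max C0 C1 \<le> f x" for x
  proof -
    consider "X \<le> x" | "x \<le> - X" | "\<bar>x\<bar> \<le> X" by linarith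
    then show ?thesis using assms(2,3)[of x] C1[of x] by cases linarith+
  qed
  then show ?thesis by blast
qed

text \<open>Far out, the slope of \<open>U\<close> exceeds any \<open>M\<close> in the outward
  direction; compactness handles the middle. The first bound serves the properness of the energy,
  the second the confinement of equilibria.\<close>

lemma superlinear_bounds:
  assumes U: "smooth_real_on UNIV U" and "filterlim (deriv U) at_top at_top" "filterlim (deriv U) at_bot at_bot"
  shows "\<exists>C. \<forall>x. M * \<bar>x\<bar> - C \<le> U x" "\<exists>C. \<forall>x. M * \<bar>x\<bar> - C \<le> x * deriv U x"
proof -
  have D: "(U has_real_derivative deriv U x) (at x)" for x
    using smooth_real_on_imp_DERIV[OF U] by simp
  have "eventually (\<lambda>x. M \<le> deriv U x) at_top" "eventually (\<lambda>x. deriv U x \<le> - M) at_bot"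
    using assms(2,3) by (auto simp: filterlim_at_top filterlim_at_bot)
  then obtain a b where ab: "\<And>x. a \<le> x \<Longrightarrow> M \<le> deriv U x" "\<And>x. x \<le> b \<Longrightarrow> deriv U x \<le> - M"
    unfolding eventually_at_top_linorder eventually_at_bot_linorder by blast
  define X where "X = max 0 (max a (- b))"
  have X: "X \<ge> 0" "\<And>x. X \<le> x \<Longrightarrow> M \<le> deriv U x" "\<And>x. x \<le> - X \<Longrightarrow> deriv U x \<le> - M"
    using ab by (auto simp: X_def)
  show "\<exists>C. \<forall>x. M * \<bar>x\<bar> - C \<le> x * deriv U x"
  proof (rule lower_bound_from_tails[where X = X and ?C0.0 = 0])
    show "continuous_on UNIV (\<lambda>x. x * deriv U x)"
      by (intro continuous_intros smooth_real_on_continuous_on smooth_real_on_deriv U)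
    show "M * \<bar>x\<bar> - 0 \<le> x * deriv U x" if "X \<le> x" for x
      using mult_left_mono[OF X(2)[OF that], of x] X(1) that by (simp add: mult.commute)
    show "M * \<bar>x\<bar> - 0 \<le> x * deriv U x" if "x \<le> - X" for x
      using mult_left_mono_neg[OF X(3)[OF that], of x] X(1) that by (simp add: mult.commute)
  qed
  show "\<exists>C. \<forall>x. M * \<bar>x\<bar> - C \<le> U x"
  proof (rule lower_bound_from_tails[where X = X and ?C0.0 = "M * X - min (U X) (U (- X))"])
    show "continuous_on UNIV U" by (rule smooth_real_on_continuous_on[OF U])
    show "M * \<bar>x\<bar> - (M * X - min (U X) (U (- X))) \<le> U x" if "X \<le> x" for x
    proof -
      have "U X - M * X \<le> U x - M * x"
      proof (rule DERIV_nonneg_imp_nondecreasing[OF that])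
        fix y assume "X \<le> y" "y \<le> x"
        then show "\<exists>d. ((\<lambda>x. U x - M * x) has_real_derivative d) (at y) \<and> 0 \<le> d"
          using X(2)[of y] by (intro exI[of _ "deriv U y - M"]) (auto intro!: derivative_eq_intros D)
      qed
      then show ?thesis using X(1) that by simp
    qed
    show "M * \<bar>x\<bar> - (M * X - min (U X) (U (- X))) \<le> U x" if "x \<le> - X" for x
    proof -
      have "U (- X) + M * (- X) \<le> U x + M * x"
      proof (rule DERIV_nonpos_imp_nonincreasing[OF that])
        fix y assume "x \<le> y" "y \<le> - X"
        then show "\<exists>d. ((\<lambda>x. U x + M * x) has_real_derivative d) (at y) \<and> d \<le> 0"
          using X(3)[of y] by (intro exI[of _ "deriv U y + M"]) (auto intro!: derivative_eq_intros D)
      qed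
      then show ?thesis using X(1) that by simp
    qed
  qed
qed

text \<open>\<open>deriv V\<close> increases on each of the two half-lines outside
  \<open>[-R, R]\<close>, so it is bounded below for positive and above for negative arguments.
  Hence neither \<open>V\<close> nor \<open>x * deriv V x\<close> can fall faster than
  linearly.\<close>

lemma convex_outside_bounds:
  assumes V: "smooth_real_on UNIV V" and R: "R \<ge> 0" and "\<And>x. \<bar>x\<bar> \<ge> R \<Longrightarrow> (deriv ^^ 2) V x > 0"
  shows "\<exists>C. \<forall>x. - C * (1 + \<bar>x\<bar>) \<le> V x" "\<exists>C. \<forall>x. - C * (1 + \<bar>x\<bar>) \<le> x * deriv V x"
proof -
  have D: "(V has_real_derivative deriv V x) (at x)"
    "(deriv V has_real_derivative deriv (deriv V) x) (at x)" for x
    using smooth_real_on_imp_DERIV V smooth_real_on_deriv by blast+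
  have conv: "deriv (deriv V) x \<ge> 0" if "\<bar>x\<bar> \<ge> R" for x
    using assms(3)[OF that] by (simp add: numeral_2_eq_2)
  obtain C where C: "C \<ge> 0" "\<And>x. \<bar>x\<bar> \<le> R \<Longrightarrow> \<bar>deriv V x\<bar> \<le> C"
    by (rule continuous_bounded_interval[OF smooth_real_on_continuous_on[OF smooth_real_on_deriv[OF V]],
          where X = R]) blast
  have pos: "- C \<le> deriv V x" if "x \<ge> 0" for x
  proof (cases "x \<le> R")
    case False
    have "deriv V R \<le> deriv V x"
      by (rule DERIV_nonneg_imp_nondecreasing[of R]) (use False R conv D in \<open>force+\<close>)
    then show ?thesis using C(2)[of R] R by simp
  qed (use C(2)[of x] that in simp)
  have neg: "deriv V x \<le> C" if "x \<le> 0" for x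
  proof (cases "- R \<le> x")
    case False
    have "deriv V x \<le> deriv V (- R)"
      by (rule DERIV_nonneg_imp_nondecreasing[of x]) (use False R conv D in \<open>force+\<close>)
    then show ?thesis using C(2)[of "- R"] R by simp
  qed (use C(2)[of x] that in simp)
  have "- C * (1 + \<bar>x\<bar>) \<le> x * deriv V x" for x
  proof (cases "x \<ge> 0")
    case True
    then have "- C * x \<le> x * deriv V x" using mult_left_mono[OF pos, of x x] by (simp add: mult.commute)
    then show ?thesis using C(1) True by (simp add: algebra_simps)
  next
    case False
    then have "C * x \<le> x * deriv V x" using mult_left_mono_neg[OF neg, of x x] by (simp add: mult.commute)
    moreover have "- C * (1 + \<bar>x\<bar>) = C * x - C" using False by (simp add: algebra_simps)
    ultimately show ?thesis using C(1) by linarith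
  qed
  then show "\<exists>C. \<forall>x. - C * (1 + \<bar>x\<bar>) \<le> x * deriv V x" by blast
  have "- (C + \<bar>V 0\<bar>) * (1 + \<bar>x\<bar>) \<le> V x" for x
  proof -
    have "V 0 - C * \<bar>x\<bar> \<le> V x"
    proof (cases "x \<ge> 0")
      case True
      have "V 0 + C * 0 \<le> V x + C * x"
      proof (rule DERIV_nonneg_imp_nondecreasing[OF True])
        fix y :: real assume "0 \<le> y"
        then show "\<exists>d. ((\<lambda>x. V x + C * x) has_real_derivative d) (at y) \<and> 0 \<le> d"
          using pos[of y] by (intro exI[of _ "deriv V y + C"]) (auto intro!: derivative_eq_intros D)
      qed
      then show ?thesis using True by simp
    next
      case False
      then have "x \<le> 0" by simp
      have "V 0 - C * 0 \<le> V x - C * x"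
      proof (rule DERIV_nonpos_imp_nonincreasing[OF \<open>x \<le> 0\<close>])
        fix y :: real assume "y \<le> 0"
        then show "\<exists>d. ((\<lambda>x. V x - C * x) has_real_derivative d) (at y) \<and> d \<le> 0"
          using neg[of y] by (intro exI[of _ "deriv V y - C"]) (auto intro!: derivative_eq_intros D)
      qed
      then show ?thesis using False by simp
    qed
    moreover have "\<bar>V 0\<bar> * \<bar>x\<bar> \<ge> 0" by simp
    moreover have "- (C + \<bar>V 0\<bar>) * (1 + \<bar>x\<bar>) = - C - \<bar>V 0\<bar> - C * \<bar>x\<bar> - \<bar>V 0\<bar> * \<bar>x\<bar>"
      by (simp add: algebra_simps)
    ultimately show ?thesis using C(1) by linarith
  qed
  then show "\<exists>C. \<forall>x. - C * (1 + \<bar>x\<bar>) \<le> V x" by blast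
qed

lemma norm_le_sum_enumerated:
  assumes "bij_betw idx {1..CARD('n)} (UNIV :: 'n::finite set)"
  shows "norm (y :: real^'n) \<le> (\<Sum>j = 1..CARD('n). \<bar>y $ idx j\<bar>)"
  using norm_le_l1_cart[of y] sum.reindex_bij_betw[OF assms, of "\<lambda>i. \<bar>y $ i\<bar>"] by simp

text \<open>By the triangle inequality the \<open>g\<close> terms charge each coordinate of
  \<open>q\<close> at most twice, with slope \<open>C\<close>; the \<open>f\<close> terms supply
  slope \<open>2 * C + 1\<close>, which leaves the l1 norm of \<open>q\<close>. Applied to the
  potentials and to the products of positions with forces.\<close>

lemma chain_potential_coercive:
  fixes idx :: "nat \<Rightarrow> 'n::finite" and f g :: "nat \<Rightarrow> real \<Rightarrow> real"
  assumes idx: "bij_betw idx {1..CARD('n)} UNIV"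
    and f: "\<And>j M. j \<in> {1..CARD('n)} \<Longrightarrow> \<exists>C. \<forall>x. M * \<bar>x\<bar> - C \<le> f j x"
    and g: "\<And>j. j \<in> {1..CARD('n) - 1} \<Longrightarrow> \<exists>C. \<forall>x. - C * (1 + \<bar>x\<bar>) \<le> g j x"
  shows "\<exists>D. \<forall>q. norm (q :: real^'n) - D \<le> (\<Sum>j = 1..CARD('n). f j (q $ idx j))
      + (\<Sum>j = 1..CARD('n) - 1. g j (q $ idx j - q $ idx (j + 1)))"
proof -
  define n where "n = CARD('n) - 1"
  have N: "CARD('n) = Suc n" by (simp add: n_def)
  obtain c where c: "\<And>j x. j \<in> {1..n} \<Longrightarrow> - c j * (1 + \<bar>x\<bar>) \<le> g j x"
    using g unfolding n_def by metis
  define C where "C = (\<Sum>j = 1..n. \<bar>c j\<bar>)"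
  have C0: "C \<ge> 0" by (simp add: C_def sum_nonneg)
  have gC: "- C * (1 + \<bar>x\<bar>) \<le> g j x" if j: "j \<in> {1..n}" for j x
  proof -
    have "\<bar>c j\<bar> \<le> C" unfolding C_def using j by (intro member_le_sum) auto
    then have "c j \<le> C" by simp
    then have "c j * (1 + \<bar>x\<bar>) \<le> C * (1 + \<bar>x\<bar>)" by (intro mult_right_mono) auto
    then show ?thesis using c[OF j, of x] by simp
  qed
  obtain d where d: "\<And>j x. j \<in> {1..Suc n} \<Longrightarrow> (2 * C + 1) * \<bar>x\<bar> - d j \<le> f j x"
    using f[of _ "2 * C + 1"] unfolding N by metis
  have "norm q - ((\<Sum>j = 1..Suc n. d j) + real n * C) \<le> (\<Sum>j = 1..Suc n. f j (q $ idx j))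
      + (\<Sum>j = 1..n. g j (q $ idx j - q $ idx (j + 1)))" for q :: "real^'n"
  proof -
    define s where "s = (\<Sum>j = 1..Suc n. \<bar>q $ idx j\<bar>)"
    have "(\<Sum>j = 1..Suc n. (2 * C + 1) * \<bar>q $ idx j\<bar> - d j) \<le> (\<Sum>j = 1..Suc n. f j (q $ idx j))"
      by (rule sum_mono) (rule d)
    moreover have "(\<Sum>j = 1..Suc n. (2 * C + 1) * \<bar>q $ idx j\<bar> - d j) = (2 * C + 1) * s - (\<Sum>j = 1..Suc n. d j)"
      unfolding s_def sum_subtractf sum_distrib_left ..
    moreover have "(\<Sum>j = 1..n. - C * (1 + (\<bar>q $ idx j\<bar> + \<bar>q $ idx (j + 1)\<bar>)))
        \<le> (\<Sum>j = 1..n. g j (q $ idx j - q $ idx (j + 1)))"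
    proof (rule sum_mono)
      fix j assume j: "j \<in> {1..n}"
      have "C * (1 + \<bar>q $ idx j - q $ idx (j + 1)\<bar>) \<le> C * (1 + (\<bar>q $ idx j\<bar> + \<bar>q $ idx (j + 1)\<bar>))"
        using C0 by (intro mult_left_mono) auto
      then show "- C * (1 + (\<bar>q $ idx j\<bar> + \<bar>q $ idx (j + 1)\<bar>)) \<le> g j (q $ idx j - q $ idx (j + 1))"
        using gC[OF j, of "q $ idx j - q $ idx (j + 1)"] by simp
    qed
    moreover have "(\<Sum>j = 1..n. - C * (1 + (\<bar>q $ idx j\<bar> + \<bar>q $ idx (j + 1)\<bar>)))
        = - C * (real n + ((\<Sum>j = 1..n. \<bar>q $ idx j\<bar>) + (\<Sum>j = 1..n. \<bar>q $ idx (j + 1)\<bar>)))"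
      by (simp only: sum_distrib_left[symmetric] sum.distrib) simp
    moreover have "C * (real n + ((\<Sum>j = 1..n. \<bar>q $ idx j\<bar>) + (\<Sum>j = 1..n. \<bar>q $ idx (j + 1)\<bar>)))
        \<le> C * (real n + (s + s))"
    proof (intro mult_left_mono add_left_mono add_mono C0)
      show "(\<Sum>j = 1..n. \<bar>q $ idx j\<bar>) \<le> s" unfolding s_def by (rule sum_mono2) auto
      have "(\<Sum>j = 1..n. \<bar>q $ idx (j + 1)\<bar>) = (\<Sum>j = 2..Suc n. \<bar>q $ idx j\<bar>)"
        by (rule sum.reindex_bij_witness[of _ "\<lambda>j. j - 1" "\<lambda>j. j + 1"]) auto
      also have "\<dots> \<le> s" unfolding s_def by (rule sum_mono2) auto
      finally show "(\<Sum>j = 1..n. \<bar>q $ idx (j + 1)\<bar>) \<le> s" .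
    qed
    moreover have "norm q \<le> s" using norm_le_sum_enumerated[OF idx, of q] by (simp add: s_def N)
    moreover have "(2 * C + 1) * s - C * (real n + (s + s)) = s - real n * C" by (simp add: algebra_simps)
    ultimately show ?thesis by linarith
  qed
  then show ?thesis unfolding N diff_Suc_1 by blast
qed

text \<open>Abel summation. With \<open>y\<close> the momenta it yields the energy balance, with
  \<open>y\<close> the positions the virial identity.\<close>

lemma sum_by_parts:
  fixes y v :: "nat \<Rightarrow> real"
  shows "(\<Sum>j = 1..Suc n. y j * (v (j - 1) - v j))
    = y 1 * v 0 - y (Suc n) * v (Suc n) - (\<Sum>j = 1..n. (y j - y (j + 1)) * v j)"
  by (induction n) (simp_all add: algebra_simps)

section \<open>The chain as a smooth dissipative system with proper energy\<close>

locale oscillator_chain =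
  fixes idx :: "nat \<Rightarrow> 'n::finite" and U V :: "nat \<Rightarrow> real \<Rightarrow> real" and R :: real
  assumes idx: "bij_betw idx {1..CARD('n)} UNIV"
    and N2: "CARD('n) \<ge> 2"
    and smooth_U: "\<And>k. k \<in> {1..CARD('n)} \<Longrightarrow> smooth_real_on UNIV (U k)"
    and smooth_V: "\<And>k. k \<in> {1..CARD('n) - 1} \<Longrightarrow> smooth_real_on UNIV (V k)"
    and R: "R \<ge> 0"
    and convex_V: "\<And>k x. k \<in> {1..CARD('n) - 1} \<Longrightarrow> \<bar>x\<bar> \<ge> R \<Longrightarrow> (deriv ^^ 2) (V k) x > 0"
    and U_top: "\<And>k. k \<in> {1..CARD('n)} \<Longrightarrow> filterlim (deriv (U k)) at_top at_top"
    and U_bot: "\<And>k. k \<in> {1..CARD('n)} \<Longrightarrow> filterlim (deriv (U k)) at_bot at_bot"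
    and V_nondeg: "\<And>k x. k \<in> {1..CARD('n) - 1} \<Longrightarrow> (deriv ^^ 2) (V k) x \<noteq> 0 \<or> (deriv ^^ 3) (V k) x \<noteq> 0"
begin

abbreviation "H \<equiv> hamiltonian idx U V"
abbreviation "F \<equiv> damped_field idx U V"

definition p :: "nat \<Rightarrow> (real^'n) \<times> (real^'n) \<Rightarrow> real" where "p j x = fst x $ idx j"
definition q :: "nat \<Rightarrow> (real^'n) \<times> (real^'n) \<Rightarrow> real" where "q j x = snd x $ idx j"
text \<open>For \<open>j = 0\<close> and \<open>j = CARD('n)\<close> this reads \<open>idx\<close>
  outside its range; \<open>v j\<close> is identically zero there.\<close>

definition u :: "nat \<Rightarrow> (real^'n) \<times> (real^'n) \<Rightarrow> real" where "u j x = q j x - q (j + 1) x"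
definition v :: "nat \<Rightarrow> (real^'n) \<times> (real^'n) \<Rightarrow> real" where "v j x = deriv (bdry_V CARD('n) V j) (u j x)"

lemma N_Suc: "CARD('n) = Suc (CARD('n) - 1)" using N2 by simp

lemma p_inner: "p j = (\<lambda>x. x \<bullet> (axis (idx j) 1, 0))"
  by (rule ext) (simp add: p_def inner_prod_def inner_axis)

lemma q_inner: "q j = (\<lambda>x. x \<bullet> (0, axis (idx j) 1))"
  by (rule ext) (simp add: q_def inner_prod_def inner_axis)

lemma smooth_p: "smooth_fun (p j)" unfolding p_inner by (rule smooth_fun.coord)
lemma smooth_q: "smooth_fun (q j)" unfolding q_inner by (rule smooth_fun.coord)
lemma smooth_u: "smooth_fun (u j)" unfolding u_def by (rule smooth_fun_diff[OF smooth_q smooth_q])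

lemma smooth_bdry_V: "smooth_real_on UNIV (bdry_V CARD('n) V j)"
  using smooth_V by (auto simp: bdry_V_def smooth_real_on_const)

lemma smooth_v: "smooth_fun (v j)"
  unfolding v_def by (rule smooth_fun.compose[OF smooth_real_on_deriv[OF smooth_bdry_V] smooth_u])

lemma v_boundary: "v 0 = (\<lambda>_. 0)" "v CARD('n) = (\<lambda>_. 0)"
  by (auto simp: v_def bdry_V_def fun_eq_iff)

lemma v_interior: "j \<in> {1..CARD('n) - 1} \<Longrightarrow> v j = (\<lambda>x. deriv (V j) (u j x))"
  by (auto simp: v_def bdry_V_def fun_eq_iff)

lemma smooth_U': "j \<in> {1..CARD('n)} \<Longrightarrow> smooth_fun (\<lambda>x. deriv (U j) (q j x))"
  using smooth_fun.compose[OF smooth_real_on_deriv[OF smooth_U] smooth_q] by blast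

definition damping :: "nat \<Rightarrow> (real^'n) \<times> (real^'n) \<Rightarrow> real" where
  "damping j x = (if j = 1 then p 1 x else 0)"

lemma smooth_damping: "smooth_fun (damping j)"
  unfolding damping_def by (cases "j = 1") (simp_all add: smooth_p smooth_fun.const)

lemma field_p:
  assumes j: "j \<in> {1..CARD('n)}"
  shows "F x \<bullet> (axis (idx j) 1, 0) = - damping j x - deriv (U j) (q j x) + v (j - 1) x - v j x"
proof -
  have "inv_into {1..CARD('n)} idx (idx j) = j"
    using idx j by (simp add: bij_betw_def)
  then show ?thesis
    using j by (simp add: damped_field_def damped_force_def inner_prod_def inner_axis split_beta
        damping_def p_def q_def u_def v_def)
qed

lemma field_q: "F x \<bullet> (0, axis (idx j) 1) = p j x"
  by (simp add: damped_field_def inner_prod_def inner_axis split_beta p_def)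

lemma smooth_F: "smooth_field F"
  unfolding smooth_field_def
proof
  fix b :: "(real^'n) \<times> (real^'n)" assume "b \<in> Basis"
  then obtain i where "b = (axis i 1, 0) \<or> b = (0, axis i 1)"
    by (auto simp: Basis_prod_def Basis_vec_def)
  moreover obtain j where j: "j \<in> {1..CARD('n)}" "i = idx j"
    using idx by (metis UNIV_I bij_betw_imp_surj_on imageE)
  moreover have "smooth_fun (\<lambda>x. F x \<bullet> (axis (idx j) 1, 0))"
    unfolding field_p[OF j(1)]
    by (intro smooth_fun_diff[OF smooth_fun.add[OF smooth_fun_diff[OF smooth_fun_minus]]]
        smooth_damping smooth_v smooth_U'[OF j(1)])
  moreover have "smooth_fun (\<lambda>x. F x \<bullet> (0, axis (idx j) 1))"
    unfolding field_q by (rule smooth_p)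
  ultimately show "smooth_fun (\<lambda>x. F x \<bullet> b)" by blast
qed

lemma lie_coord: "lie G (\<lambda>x. x \<bullet> b) x = G x \<bullet> b"
proof -
  have "GDERIV (\<lambda>x. x \<bullet> b) x :> b"
    unfolding gderiv_def by (auto intro!: derivative_eq_intros)
  then show ?thesis by (simp add: lie_eq inner_commute)
qed

lemma lie_p: "j \<in> {1..CARD('n)} \<Longrightarrow>
    lie F (p j) = (\<lambda>x. - damping j x - deriv (U j) (q j x) + v (j - 1) x - v j x)"
  by (rule ext) (simp add: p_inner lie_coord field_p)

lemma lie_q: "lie F (q j) = p j"
  by (rule ext) (simp add: q_inner lie_coord field_q)

lemma lie_u: "lie F (u j) = (\<lambda>x. p j x - p (j + 1) x)"
proof
  fix x show "lie F (u j) x = p j x - p (j + 1) x"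
    using lie_diff[OF smooth_q smooth_q, of F j "j + 1" x] by (simp add: u_def[abs_def] lie_q)
qed

lemma H_eq: "H = (\<lambda>x. (\<Sum>j = 1..CARD('n). (1/2) * (p j x * p j x)) + (\<Sum>j = 1..CARD('n). U j (q j x))
    + (\<Sum>j = 1..CARD('n) - 1. V j (u j x)))"
  by (auto simp: hamiltonian_def fun_eq_iff p_def q_def u_def power2_eq_square)

lemma smooth_pp: "smooth_fun (\<lambda>x. (1/2) * (p j x * p j x))"
  by (rule smooth_fun.mult[OF smooth_fun.const smooth_fun.mult[OF smooth_p smooth_p]])

lemma smooth_Uq: "j \<in> {1..CARD('n)} \<Longrightarrow> smooth_fun (\<lambda>x. U j (q j x))"
  using smooth_fun.compose[OF smooth_U smooth_q] by blast

lemma smooth_Vu: "j \<in> {1..CARD('n) - 1} \<Longrightarrow> smooth_fun (\<lambda>x. V j (u j x))"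
  using smooth_fun.compose[OF smooth_V smooth_u] by blast

lemma smooth_H: "smooth_fun H"
  unfolding H_eq
  by (rule smooth_fun.add[OF smooth_fun.add[OF smooth_fun_sum smooth_fun_sum] smooth_fun_sum])
    (use smooth_pp smooth_Uq smooth_Vu in auto)

lemma lie_H: "lie F H = (\<lambda>x. - (p 1 x * p 1 x))"
proof
  fix x
  have 1: "lie F (\<lambda>x. (1/2) * (p j x * p j x)) x = p j x * lie F (p j) x" for j
    using lie_mult[OF smooth_fun.const smooth_fun.mult[OF smooth_p smooth_p], of F "1/2" j j x]
      lie_mult[OF smooth_p smooth_p, of F j j x] lie_const[of F "1/2" x] by simp
  have sums: "smooth_fun (\<lambda>x. \<Sum>j = 1..CARD('n). (1/2) * (p j x * p j x))"
    "smooth_fun (\<lambda>x. \<Sum>j = 1..CARD('n). U j (q j x))" "smooth_fun (\<lambda>x. \<Sum>j = 1..CARD('n) - 1. V j (u j x))"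
    by (rule smooth_fun_sum; use smooth_pp smooth_Uq smooth_Vu in blast)+
  have "lie F H x = lie F (\<lambda>x. \<Sum>j = 1..CARD('n). (1/2) * (p j x * p j x)) x
      + lie F (\<lambda>x. \<Sum>j = 1..CARD('n). U j (q j x)) x + lie F (\<lambda>x. \<Sum>j = 1..CARD('n) - 1. V j (u j x)) x"
    unfolding H_eq using lie_add[OF smooth_fun.add[OF sums(1,2)] sums(3)] lie_add[OF sums(1,2)] by simp
  also have "\<dots> = (\<Sum>j = 1..CARD('n). p j x * lie F (p j) x) + (\<Sum>j = 1..CARD('n). deriv (U j) (q j x) * p j x)
      + (\<Sum>j = 1..CARD('n) - 1. deriv (V j) (u j x) * (p j x - p (j + 1) x))"
  proof -
    have "lie F (\<lambda>x. \<Sum>j = 1..CARD('n). (1/2) * (p j x * p j x)) x = (\<Sum>j = 1..CARD('n). p j x * lie F (p j) x)"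
      by (subst lie_sum[OF smooth_pp]) (simp only: 1)
    moreover have "lie F (\<lambda>x. \<Sum>j = 1..CARD('n). U j (q j x)) x = (\<Sum>j = 1..CARD('n). deriv (U j) (q j x) * p j x)"
      by (subst lie_sum[OF smooth_Uq], assumption, rule sum.cong)
        (simp_all add: lie_compose[OF smooth_U smooth_q] lie_q)
    moreover have "lie F (\<lambda>x. \<Sum>j = 1..CARD('n) - 1. V j (u j x)) x
        = (\<Sum>j = 1..CARD('n) - 1. deriv (V j) (u j x) * (p j x - p (j + 1) x))"
      by (subst lie_sum[OF smooth_Vu], assumption, rule sum.cong)
        (simp_all add: lie_compose[OF smooth_V smooth_u] lie_u)
    ultimately show ?thesis by simp
  qed
  also have "(\<Sum>j = 1..CARD('n). p j x * lie F (p j) x)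
      = (\<Sum>j = 1..CARD('n). - (p j x * damping j x)) + (\<Sum>j = 1..CARD('n). - (deriv (U j) (q j x) * p j x))
        + (\<Sum>j = 1..CARD('n). p j x * (v (j - 1) x - v j x))"
    unfolding sum.distrib[symmetric] by (rule sum.cong) (auto simp: lie_p algebra_simps)
  \<comment> \<open>The boundary terms vanish with \<open>v 0\<close> and \<open>v CARD('n)\<close>,
    so the work of the interaction forces cancels the change of the interaction energy.\<close>
  also have "(\<Sum>j = 1..CARD('n). p j x * (v (j - 1) x - v j x))
      = - (\<Sum>j = 1..CARD('n) - 1. deriv (V j) (u j x) * (p j x - p (j + 1) x))"
    using sum_by_parts[of "\<lambda>j. p j x" "\<lambda>j. v j x" "CARD('n) - 1"]
    by (simp add: N_Suc[symmetric] v_boundary v_interior mult.commute)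
  also have "(\<Sum>j = 1..CARD('n). - (p j x * damping j x)) = - (p 1 x * p 1 x)"
  proof -
    have "(\<Sum>j = 1..CARD('n). - (p j x * damping j x)) = (\<Sum>j = 1..CARD('n). if 1 = j then - (p j x * p j x) else 0)"
      by (rule sum.cong) (auto simp: damping_def)
    then show ?thesis using N2 by simp
  qed
  finally show "lie F H x = - (p 1 x * p 1 x)" by (simp add: sum_negf)
qed

lemma H_coercive: "\<exists>D. \<forall>x. (\<Sum>j = 1..CARD('n). (p j x)\<^sup>2 / 2) + norm (snd x) - D \<le> H x"
proof -
  have "\<exists>D. \<forall>q. norm (q :: real^'n) - D \<le> (\<Sum>j = 1..CARD('n). U j (q $ idx j))
      + (\<Sum>j = 1..CARD('n) - 1. V j (q $ idx j - q $ idx (j + 1)))"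
    by (rule chain_potential_coercive[OF idx superlinear_bounds(1)[OF smooth_U U_top U_bot]
          convex_outside_bounds(1)[OF smooth_V R convex_V]])
  then obtain D where D: "\<And>q. norm (q :: real^'n) - D \<le> (\<Sum>j = 1..CARD('n). U j (q $ idx j))
      + (\<Sum>j = 1..CARD('n) - 1. V j (q $ idx j - q $ idx (j + 1)))" by blast
  have "(\<Sum>j = 1..CARD('n). (p j x)\<^sup>2 / 2) + norm (snd x) - D \<le> H x" for x
    using D[of "snd x"] by (simp add: hamiltonian_def split_beta p_def)
  then show ?thesis by blast
qed

lemma proper_H: "proper_fun H"
  unfolding proper_fun_def
proof
  fix c
  obtain D where D: "\<And>x. (\<Sum>j = 1..CARD('n). (p j x)\<^sup>2 / 2) + norm (snd x) - D \<le> H x"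
    using H_coercive by blast
  have "norm x \<le> real CARD('n) * (1 + 2 * (c + D)) + (c + D)" if "H x \<le> c" for x
  proof -
    have s: "(\<Sum>j = 1..CARD('n). (p j x)\<^sup>2 / 2) + norm (snd x) \<le> c + D" using D[of x] that by simp
    have q: "norm (snd x) \<le> c + D" using s sum_nonneg[of "{1..CARD('n)}" "\<lambda>j. (p j x)\<^sup>2 / 2"] by simp
    have "\<bar>p j x\<bar> \<le> 1 + 2 * (c + D)" if j: "j \<in> {1..CARD('n)}" for j
    proof -
      have "(p j x)\<^sup>2 / 2 \<le> (\<Sum>j = 1..CARD('n). (p j x)\<^sup>2 / 2)" using j by (intro member_le_sum) auto
      then have "(p j x)\<^sup>2 \<le> 2 * (c + D)" using s norm_ge_zero[of "snd x"] by argo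
      moreover have "\<bar>p j x\<bar> \<le> 1 + (p j x)\<^sup>2"
        using sum_squares_bound[of "\<bar>p j x\<bar>" 1] by simp
      ultimately show ?thesis by linarith
    qed
    then have "(\<Sum>j = 1..CARD('n). \<bar>fst x $ idx j\<bar>) \<le> (\<Sum>j = 1..CARD('n). 1 + 2 * (c + D))"
      unfolding p_def by (rule sum_mono)
    then have "norm (fst x) \<le> real CARD('n) * (1 + 2 * (c + D))"
      using norm_le_sum_enumerated[OF idx, of "fst x"] by simp
    then show ?thesis using q norm_Pair_le[of "fst x" "snd x"] by simp
  qed
  then have "bounded {x. H x \<le> c}" by (auto simp: bounded_iff)
  moreover have "closed {x. H x \<le> c}"
    by (intro closed_Collect_le continuous_on_const smooth_fun_continuous_on[OF smooth_H])
  ultimately show "compact {x. H x \<le> c}" by (simp add: compact_eq_bounded_closed)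
qed

text \<open>Virial argument: the force balance at site \<open>j\<close>, multiplied by
  \<open>q j x\<close> and summed over the chain, says that the sum of all
  \<open>q j x * deriv (U j) (q j x)\<close> and \<open>u j x * deriv (V j) (u j x)\<close> is zero,
  whereas coercivity bounds it below by \<open>norm (snd x) - D\<close>.\<close>

lemma equilibria_bounded:
  "\<exists>D. \<forall>x. (\<forall>j\<in>{1..CARD('n)}. p j x = 0 \<and> lie F (p j) x = 0) \<longrightarrow> norm x \<le> D"
proof -
  have "\<exists>D. \<forall>q. norm (q :: real^'n) - D \<le> (\<Sum>j = 1..CARD('n). q $ idx j * deriv (U j) (q $ idx j))
      + (\<Sum>j = 1..CARD('n) - 1. (q $ idx j - q $ idx (j + 1)) * deriv (V j) (q $ idx j - q $ idx (j + 1)))"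
    by (rule chain_potential_coercive[OF idx superlinear_bounds(2)[OF smooth_U U_top U_bot]
          convex_outside_bounds(2)[OF smooth_V R convex_V]])
  then obtain D where D: "\<And>q. norm (q :: real^'n) - D \<le> (\<Sum>j = 1..CARD('n). q $ idx j * deriv (U j) (q $ idx j))
      + (\<Sum>j = 1..CARD('n) - 1. (q $ idx j - q $ idx (j + 1)) * deriv (V j) (q $ idx j - q $ idx (j + 1)))"
    by blast
  have "norm x \<le> D" if x: "\<And>j. j \<in> {1..CARD('n)} \<Longrightarrow> p j x = 0" "\<And>j. j \<in> {1..CARD('n)} \<Longrightarrow> lie F (p j) x = 0" for x
  proof -
    have "deriv (U j) (q j x) = v (j - 1) x - v j x" if j: "j \<in> {1..CARD('n)}" for j
      using x(2)[OF j] x(1)[OF j] lie_p[OF j] by (auto simp: damping_def split: if_splits)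
    then have "(\<Sum>j = 1..CARD('n). q j x * deriv (U j) (q j x)) = (\<Sum>j = 1..CARD('n). q j x * (v (j - 1) x - v j x))"
      by (intro sum.cong) auto
    also have "\<dots> = - (\<Sum>j = 1..CARD('n) - 1. u j x * deriv (V j) (u j x))"
      using sum_by_parts[of "\<lambda>j. q j x" "\<lambda>j. v j x" "CARD('n) - 1"]
      by (simp add: N_Suc[symmetric] v_boundary v_interior u_def)
    finally have "norm (snd x) \<le> D"
      using D[of "snd x"] by (simp add: q_def u_def)
    moreover have "fst x = 0"
    proof -
      have "norm (fst x) \<le> (\<Sum>j = 1..CARD('n). \<bar>fst x $ idx j\<bar>)" by (rule norm_le_sum_enumerated[OF idx])
      also have "\<dots> = 0" using x(1) by (intro sum.neutral) (auto simp: p_def)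
      finally show ?thesis by simp
    qed
    moreover have "norm x \<le> norm (fst x) + norm (snd x)" using norm_Pair_le[of "fst x" "snd x"] by simp
    ultimately show ?thesis by simp
  qed
  then show ?thesis by blast
qed

section \<open>Flatness of the momenta along the chain\<close>

context
  fixes x :: "(real^'n) \<times> (real^'n)"
begin

abbreviation "T \<equiv> lie_series F x"

text \<open>Newton's equation at site \<open>j\<close> is solved for \<open>v j\<close> and
  differentiated once: the forces need not vanish, but their time derivatives carry factors
  \<open>p i\<close>. The worst term, \<open>p j\<close> differentiated twice, leaves order
  \<open>6 * K - 5 = 2 * (3 * K - 3) + 1\<close>, which halves to \<open>3 * K - 3\<close>.\<close>

lemma p_flat_step:
  assumes j: "1 \<le> j" "j < CARD('n)"
    and IH: "\<And>i. 1 \<le> i \<Longrightarrow> i \<le> j \<Longrightarrow> vanishes_to (T (p i)) (6 * K - 3)" and K: "K \<ge> 1"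
  shows "vanishes_to (T (p (j + 1))) (3 * K - 3)"
proof -
  let ?m = "6 * K - 5"
  have jN: "j \<in> {1..CARD('n)}" "j \<in> {1..CARD('n) - 1}" using j by auto
  have flat: "vanishes_to (T (p i)) ?m" if "1 \<le> i" "i \<le> j" for i
    by (rule vanishes_to_mono[OF IH[OF that]]) simp
  have "v j = (\<lambda>x. v (j - 1) x - damping j x - deriv (U j) (q j x) - lie F (p j) x)"
    by (auto simp: lie_p[OF jN(1)])
  then have "T (v j) = T (\<lambda>x. v (j - 1) x - damping j x - deriv (U j) (q j x) - lie F (p j) x)"
    by (rule arg_cong)
  also have "\<dots> = T (v (j - 1)) - T (damping j) - T (\<lambda>x. deriv (U j) (q j x)) - T (lie F (p j))"
    by (simp only: lie_series_diff[OF smooth_F] smooth_fun_diff smooth_v smooth_damping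
        smooth_U'[OF jN(1)] smooth_fun_lie[OF smooth_F smooth_p])
  finally have "T (v j) = T (v (j - 1)) - T (damping j) - T (\<lambda>x. deriv (U j) (q j x)) - T (lie F (p j))" .
  then have Tv: "fps_deriv (T (v j)) = fps_deriv (T (v (j - 1))) - fps_deriv (T (damping j))
      - fps_deriv (T (\<lambda>x. deriv (U j) (q j x))) - fps_deriv (fps_deriv (T (p j)))"
    by (simp add: lie_series_lie)
  have dv: "fps_deriv (T (v i)) = T (\<lambda>x. deriv (deriv (bdry_V CARD('n) V i)) (u i x)) * (T (p i) - T (p (i + 1)))" for i
  proof -
    have "lie F (v i) = (\<lambda>x. deriv (deriv (bdry_V CARD('n) V i)) (u i x) * (p i x - p (i + 1) x))"
      using lie_compose[OF smooth_real_on_deriv[OF smooth_bdry_V] smooth_u, of F i i]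
      by (auto simp: lie_u v_def[abs_def])
    moreover have "smooth_fun (\<lambda>x. deriv (deriv (bdry_V CARD('n) V i)) (u i x))"
      by (rule smooth_fun.compose[OF smooth_real_on_deriv[OF smooth_real_on_deriv[OF smooth_bdry_V]] smooth_u])
    ultimately show ?thesis
      using lie_series_mult[OF smooth_F _ smooth_fun_diff[OF smooth_p smooth_p]]
        lie_series_diff[OF smooth_F smooth_p smooth_p] by (simp flip: lie_series_lie)
  qed
  have 1: "vanishes_to (fps_deriv (T (v (j - 1)))) ?m"
  proof (cases "j = 1")
    case True
    then show ?thesis by (simp add: v_boundary lie_series_const vanishes_to_0)
  next
    case False
    then show ?thesis
      unfolding dv by (intro vanishes_to_mult vanishes_to_diff flat) (use j in auto)
  qed
  have 2: "vanishes_to (fps_deriv (T (damping j))) ?m"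
  proof (cases "j = 1")
    case True
    have "vanishes_to (T (p 1)) (Suc ?m)"
      by (rule vanishes_to_mono[OF IH]) (use j K in auto)
    then show ?thesis using True by (simp add: damping_def[abs_def] vanishes_to_deriv)
  qed (simp add: damping_def[abs_def] lie_series_const vanishes_to_0)
  have 3: "vanishes_to (fps_deriv (T (\<lambda>x. deriv (U j) (q j x)))) ?m"
  proof -
    have "lie F (\<lambda>x. deriv (U j) (q j x)) = (\<lambda>x. deriv (deriv (U j)) (q j x) * p j x)"
      using lie_compose[OF smooth_real_on_deriv[OF smooth_U[OF jN(1)]] smooth_q] by (auto simp: lie_q)
    moreover have "smooth_fun (\<lambda>x. deriv (deriv (U j)) (q j x))"
      by (rule smooth_fun.compose[OF smooth_real_on_deriv[OF smooth_real_on_deriv[OF smooth_U[OF jN(1)]]] smooth_q])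
    ultimately show ?thesis
      using lie_series_mult[OF smooth_F _ smooth_p] j
      by (simp add: vanishes_to_mult flat flip: lie_series_lie)
  qed
  have 4: "vanishes_to (fps_deriv (fps_deriv (T (p j)))) ?m"
  proof (intro vanishes_to_deriv)
    show "vanishes_to (T (p j)) (Suc (Suc ?m))"
      by (rule vanishes_to_mono[OF IH]) (use j K in auto)
  qed
  have "vanishes_to (fps_deriv (T (v j))) ?m"
    unfolding Tv by (intro vanishes_to_diff 1 2 3 4)
  moreover have "lie F (v j) = (\<lambda>x. deriv (deriv (V j)) (u j x) * lie F (u j) x)"
    unfolding v_interior[OF jN(2)]
    using lie_compose[OF smooth_real_on_deriv[OF smooth_V[OF jN(2)]] smooth_u] by auto
  moreover have "?m = 2 * (3 * K - 3) + 1" using K by simp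
  ultimately have "vanishes_to (T (\<lambda>x. deriv (deriv (V j)) (u j x) * lie F (u j) x)) (2 * (3 * K - 3) + 1)"
    by (simp flip: lie_series_lie)
  moreover have "deriv (deriv (V j)) (u j x) \<noteq> 0 \<or> deriv (deriv (deriv (V j))) (u j x) \<noteq> 0"
    using V_nondeg[OF jN(2), of "u j x"] by (simp add: numeral_2_eq_2 numeral_3_eq_3)
  \<comment> \<open>Here \<open>g\<close> is \<open>deriv (V j)\<close>, so the simple zeros in
    question are those of the second derivative of \<open>V j\<close>. The conclusion concerns
    \<open>lie F (u j)\<close>, the difference of the neighbouring momenta.\<close>
  ultimately have "vanishes_to (T (lie F (u j))) (3 * K - 3)"
    using lie_series_compose_vanishes[OF smooth_F smooth_u smooth_real_on_deriv[OF smooth_V[OF jN(2)]]]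
    by blast
  then have "vanishes_to (T (p j) - T (p (j + 1))) (3 * K - 3)"
    by (simp add: lie_u lie_series_diff[OF smooth_F smooth_p smooth_p])
  moreover have "vanishes_to (T (p j)) (3 * K - 3)"
    by (rule vanishes_to_mono[OF IH]) (use j in auto)
  ultimately show ?thesis by (simp add: vanishes_to_def)
qed

lemma p_flat:
  assumes "\<And>k. k \<in> {1..3 * 2 ^ (CARD('n) + 1) - 5} \<Longrightarrow> (lie F ^^ k) H x = 0" and "1 \<le> j" "j \<le> CARD('n)"
  shows "vanishes_to (T (p j)) (3 * 2 ^ (CARD('n) + 1 - j) - 3)"
  using assms(2,3)
proof (induction j rule: less_induct)
  case (less j)
  show ?case
  proof (cases "j = 1")
    case True
    \<comment> \<open>Coefficient \<open>n\<close> of the dissipation is Lie derivative number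
      \<open>n + 1\<close> of \<open>H\<close>, which explains the shift from \<open>- 5\<close> to
      \<open>- 6\<close>.\<close>
    have "fps_nth (T (\<lambda>x. - (p 1 x * p 1 x))) n = 0" if n: "n \<le> 3 * 2 ^ (CARD('n) + 1) - 6" for n
    proof -
      have "(2::nat) \<le> 2 ^ (CARD('n) + 1)" using N2 by (simp add: power_add)
      then have "Suc n \<le> 3 * 2 ^ (CARD('n) + 1) - 5" using n by linarith
      then have "(lie F ^^ Suc n) H x = 0" by (intro assms(1)) simp
      then show ?thesis by (simp add: lie_series_nth funpow_swap1 lie_H)
    qed
    moreover have "2 * (3 * 2 ^ CARD('n) - 3) = 3 * 2 ^ (CARD('n) + 1) - (6::nat)" by simp
    ultimately have "vanishes_to (T (\<lambda>x. - (p 1 x * p 1 x))) (2 * (3 * 2 ^ CARD('n) - 3))"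
      by (simp add: vanishes_to_def)
    then have "vanishes_to (- (T (p 1) * T (p 1))) (2 * (3 * 2 ^ CARD('n) - 3))"
      by (simp only: lie_series_minus[OF smooth_F smooth_fun.mult[OF smooth_p smooth_p]]
          lie_series_mult[OF smooth_F smooth_p smooth_p])
    then have "vanishes_to (T (p 1) * T (p 1)) (2 * (3 * 2 ^ CARD('n) - 3))"
      by (simp only: vanishes_to_def fps_neg_nth neg_equal_0_iff_equal)
    then have "vanishes_to (T (p 1)) (3 * 2 ^ CARD('n) - 3)"
      by (rule vanishes_to_square)
    then show ?thesis using True by simp
  next
    case False
    define i where "i = j - 1"
    have i: "j = i + 1" "1 \<le> i" "i < CARD('n)" using False less.prems by (auto simp: i_def)
    \<comment> \<open>Chosen so that \<open>6 * K - 3\<close> is the order known for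
      \<open>p i\<close>; the momenta before site \<open>i\<close> vanish to higher order.\<close>
    define K where "K = (2::nat) ^ (CARD('n) - i)"
    have "vanishes_to (T (p (i + 1))) (3 * K - 3)"
    proof (rule p_flat_step[OF i(2,3)])
      fix k assume k: "1 \<le> k" "k \<le> i"
      have "(2::nat) ^ Suc (CARD('n) - i) \<le> 2 ^ (CARD('n) + 1 - k)" by (rule power_increasing) (use k i in auto)
      then have "6 * K - 3 \<le> 3 * 2 ^ (CARD('n) + 1 - k) - 3" by (simp add: K_def)
      then show "vanishes_to (T (p k)) (6 * K - 3)"
        by (rule vanishes_to_mono[rotated]) (use less.IH[of k] k i in auto)
    qed (simp add: K_def)
    then show ?thesis using i by (simp add: K_def)
  qed
qed

end

lemma nondeg_exists: "\<exists>K. nondeg_off F H (3 * 2 ^ (CARD('n) + 1) - 5) K"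
proof -
  let ?r = "3 * 2 ^ (CARD('n) + 1) - 5 :: nat"
  \<comment> \<open>The smallest possible choice, the common zero set of the derivatives;
    \<open>p_flat\<close> shows that it consists of equilibria.\<close>
  define K where "K = {x. \<forall>k\<in>{1..?r}. (lie F ^^ k) H x = 0}"
  obtain D where D: "\<And>x. (\<forall>j\<in>{1..CARD('n)}. p j x = 0 \<and> lie F (p j) x = 0) \<Longrightarrow> norm x \<le> D"
    using equilibria_bounded by blast
  have "norm x \<le> D" if "x \<in> K" for x
  proof (rule D, rule ballI)
    fix j assume j: "j \<in> {1..CARD('n)}"
    \<comment> \<open>Even at the last site the order is \<open>3 * 2 - 3\<close>, enough for
      \<open>p j\<close> and its first Lie derivative to vanish.\<close>
    have "(2::nat) ^ 1 \<le> 2 ^ (CARD('n) + 1 - j)" by (rule power_increasing) (use j in auto)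
    then have "vanishes_to (lie_series F x (p j)) 1"
      using that j by (intro vanishes_to_mono[OF p_flat[of x j]]) (auto simp: K_def)
    then have "fps_nth (lie_series F x (p j)) 0 = 0" "fps_nth (lie_series F x (p j)) 1 = 0"
      by (simp_all add: vanishes_to_def)
    then show "p j x = 0 \<and> lie F (p j) x = 0" by (simp add: lie_series_nth)
  qed
  then have "bounded K" unfolding bounded_iff by blast
  then have "nondeg_off F H ?r K" by (auto simp: nondeg_off_def K_def)
  then show ?thesis by blast
qed

end

theorem corollary4p4:
  fixes idx :: "nat \<Rightarrow> 'n::finite"
    and U V :: "nat \<Rightarrow> real \<Rightarrow> real"
    and R :: real
    and r :: nat
    and H :: "(real^'n) \<times> (real^'n) \<Rightarrow> real"
    and F :: "(real^'n) \<times> (real^'n) \<Rightarrow> (real^'n) \<times> (real^'n)"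
  assumes "bij_betw idx {1..CARD('n)} UNIV"
    and "CARD('n) \<ge> 2"
    and "\<And>k. k \<in> {1..CARD('n)} \<Longrightarrow> smooth_real_on UNIV (U k)"
    and "\<And>k. k \<in> {1..CARD('n) - 1} \<Longrightarrow> smooth_real_on UNIV (V k)"
    and "R \<ge> 0"
    and "\<And>k x. k \<in> {1..CARD('n) - 1} \<Longrightarrow> \<bar>x\<bar> \<ge> R \<Longrightarrow> (deriv ^^ 2) (V k) x > 0"
    and "\<And>k. k \<in> {1..CARD('n)} \<Longrightarrow> filterlim (deriv (U k)) at_top at_top"
    and "\<And>k. k \<in> {1..CARD('n)} \<Longrightarrow> filterlim (deriv (U k)) at_bot at_bot"
    and "\<And>k x. k \<in> {1..CARD('n) - 1} \<Longrightarrow> (deriv ^^ 2) (V k) x \<noteq> 0 \<or> (deriv ^^ 3) (V k) x \<noteq> 0"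
    and "r = 3 * 2 ^ (CARD('n) + 1) - 5"
    and "H = hamiltonian idx U V"
    and "F = damped_field idx U V"
  shows "(\<exists>K. nondeg_off F H r K) \<and>
    (\<forall>K Q. nondeg_off F H r K \<longrightarrow> K \<subseteq> {x. H x \<le> Q} \<longrightarrow>
       nonstrict_lyapunov_outside F H Q \<and>
       (\<forall>x. x \<notin> {x. H x \<le> Q} \<longrightarrow> (\<exists>k\<in>{1..r}. (lie F ^^ k) H x \<noteq> 0)) \<and>
       (\<exists>\<phi> \<Phi>. wsharp_bounds F H r Q \<phi> \<Phi>) \<and>
       (\<forall>\<phi> \<Phi>. wsharp_bounds F H r Q \<phi> \<Phi> \<longrightarrow>
          (\<exists>A. wsharp_A F H r Q \<phi> \<Phi> A) \<and>
          (\<forall>A \<epsilon>. wsharp_A F H r Q \<phi> \<Phi> A \<longrightarrow> \<epsilon> > 0 \<longrightarrow>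
             (\<exists>W. is_wsharp F H r Q \<phi> \<Phi> A \<epsilon> W) \<and>
             (\<forall>W. is_wsharp F H r Q \<phi> \<Phi> A \<epsilon> W \<longrightarrow>
                (\<exists>Q'. strict_lyapunov_outside F W Q')))))"
proof -
  interpret chain: oscillator_chain idx U V R
    by unfold_locales (use assms in auto)
  note HF = \<open>H = hamiltonian idx U V\<close> \<open>F = damped_field idx U V\<close>
  have "(2::nat) ^ 3 \<le> 2 ^ (CARD('n) + 1)"
    by (rule power_increasing) (use assms(2) in auto)
  then have r: "r \<ge> 3" unfolding assms(10) by simp
  have dissip: "lie F H x \<le> 0" for x
    unfolding HF chain.lie_H by simp
  have "\<exists>K. nondeg_off F H r K"
    unfolding HF assms(10) by (rule chain.nondeg_exists)
  moreover have "nonstrict_lyapunov_outside F H Q \<and>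
       (\<forall>x. x \<notin> {x. H x \<le> Q} \<longrightarrow> (\<exists>k\<in>{1..r}. (lie F ^^ k) H x \<noteq> 0)) \<and>
       (\<exists>\<phi> \<Phi>. wsharp_bounds F H r Q \<phi> \<Phi>) \<and>
       (\<forall>\<phi> \<Phi>. wsharp_bounds F H r Q \<phi> \<Phi> \<longrightarrow>
          (\<exists>A. wsharp_A F H r Q \<phi> \<Phi> A) \<and>
          (\<forall>A \<epsilon>. wsharp_A F H r Q \<phi> \<Phi> A \<longrightarrow> \<epsilon> > 0 \<longrightarrow>
             (\<exists>W. is_wsharp F H r Q \<phi> \<Phi> A \<epsilon> W) \<and>
             (\<forall>W. is_wsharp F H r Q \<phi> \<Phi> A \<epsilon> W \<longrightarrow>
                (\<exists>Q'. strict_lyapunov_outside F W Q'))))"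
    if K: "nondeg_off F H r K" "K \<subseteq> {x. H x \<le> Q}" for K Q
  proof -
    have nondeg: "\<exists>k\<in>{1..r}. (lie F ^^ k) H x \<noteq> 0" if "H x > Q" for x
    proof -
      have "x \<notin> K" using K(2) that by auto
      then show ?thesis using K(1) unfolding nondeg_off_def by blast
    qed
    interpret dissipative F H r Q
      by unfold_locales
        (use chain.smooth_F chain.smooth_H chain.proper_H dissip r nondeg in \<open>auto simp: HF\<close>)
    have "nonstrict_lyapunov_outside F H Q"
      using smooth_fun_imp_C1_smooth chain.smooth_H chain.proper_H dissip
      by (auto simp: nonstrict_lyapunov_outside_def HF)
    then show ?thesis
      using nondeg wsharp_bounds_exist wsharp_A_exists is_wsharp_exists is_wsharp_strict_lyapunov
      by auto
  qed
  ultimately show ?thesis by blast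
qed

end
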